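(* Let $n\ge 3$, $d\ge 1$, let $\delta=\sum_{i=1}^n\varepsilon_i\,dx_i\otimes dx_i$ with $\varepsilon_i=\pm1$ on $\mathbb R^n$, let $(F^d,g_F)$ be a semi-Riemannian manifold with constant scalar curvature $\lambda_F$, let $\alpha=(\alpha_1,\dots,\alpha_n)\in\mathbb R^n$ be nonzero, $\xi(x)=\alpha_1x_1+\dots+\alpha_nx_n$ and $\|\alpha\|^2=\sum_i\varepsilon_i\alpha_i^2$. Let $\varphi,f,h:(a,b)\to(0,\infty)$ be smooth, and consider on $\xi^{-1}((a,b))\times F^d$ the metric $$g=\frac{\delta}{\varphi(\xi(x))^2}+f(\xi(x))^2g_F .$$ Let $\rho\in\mathbb R$. (i) If $\|\alpha\|^2\neq0$, then $g$ is a gradient Yamabe soliton with potential function $h\circ\xi$ and soliton constant $\rho$ if and only if on $(a,b)$ $$h''+2\frac{\varphi'h'}{\varphi}=0,$$ $$\|\alpha\|^2\Big[(n-1)(2\varphi\varphi''-n(\varphi')^2)-\frac{2d}{f}(\varphi^2f''-(n-2)\varphi\varphi'f')-\frac{d(d-1)}{f^2}\varphi^2(f')^2+\varphi\varphi'h'\Big]=\rho-\frac{\lambda_F}{f^2},$$ $$\|\alpha\|^2\Big[(n-1)(2\varphi\varphi''-n(\varphi')^2)-\frac{2d}{f}(\varphi^2f''-(n-2)\varphi\varphi'f')-\frac{d(d-1)}{f^2}\varphi^2(f')^2-\frac{\varphi^2}{f}f'h'\Big]=\rho-\frac{\lambda_F}{f^2}.$$ (ii) If $\|\alpha\|^2=0$,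 then $g$ is a gradient Yamabe soliton with potential function $h\circ\xi$ and soliton constant $\rho$ if and only if on $(a,b)$ $$h''+2\frac{\varphi'h'}{\varphi}=0\qquad\text{and}\qquad \rho-\frac{\lambda_F}{f^2}=0 .$$
   Context: A semi-Riemannian manifold $(M,g)$ is a gradient Yamabe soliton with potential function $u\in C^\infty(M)$ and soliton constant $\rho\in\mathbb R$ if $(S_g-\rho)g=\mathrm{Hess}_g(u)$, where $S_g$ is the scalar curvature of $g$. Primes denote derivatives with respect to the real variable $\xi\in(a,b)$. The function $h\circ\xi$ on $\xi^{-1}((a,b))$ is regarded as a function on $\xi^{-1}((a,b))\times F$ via the projection to the first factor. *)

theory Defs
  imports "HOL-Analysis.Analysis"
begin

section \<open>Smooth functions\<close>

text \<open>Only meaningful for open \<open>U\<close>: continuous on \<open>U\<close> with all iterated partial derivatives up to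
  order \<open>k\<close> existing and continuous.\<close>

primrec Ck_on :: "nat \<Rightarrow> 'a::euclidean_space set \<Rightarrow> ('a \<Rightarrow> 'b::real_normed_vector) \<Rightarrow> bool" where
  "Ck_on 0 U f = continuous_on U f"
| "Ck_on (Suc k) U f =
    (f differentiable_on U \<and> (\<forall>b\<in>Basis. Ck_on k U (\<lambda>x. frechet_derivative f (at x) b)))"

definition smooth_on :: "'a::euclidean_space set \<Rightarrow> ('a \<Rightarrow> 'b::real_normed_vector) \<Rightarrow> bool" where
  "smooth_on U f \<longleftrightarrow> (\<forall>k. Ck_on k U f)"

definition partial :: "'m::finite \<Rightarrow> (real^'m \<Rightarrow> real) \<Rightarrow> real^'m \<Rightarrow> real" where
  "partial i f y = frechet_derivative f (at y) (axis i 1)"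


section \<open>Smooth manifolds\<close>

text \<open>A manifold is a topology with an atlas, given as a family of charts indexed by \<open>Idx M\<close>.
  The atlas need not be maximal. The type \<open>'m\<close> indexes the coordinates, so the dimension is
  \<open>CARD('m) \<ge> 1\<close>.\<close>

record ('a, 'i, 'm) manifold =
  Top :: "'a topology"
  Idx :: "'i set"
  Dom :: "'i \<Rightarrow> 'a set"
  Coord :: "'i \<Rightarrow> 'a \<Rightarrow> real^'m"

definition Img :: "('a, 'i, 'm::finite) manifold \<Rightarrow> 'i \<Rightarrow> (real^'m) set" where
  "Img M i = Coord M i ` Dom M i"

definition Param :: "('a, 'i, 'm::finite) manifold \<Rightarrow> 'i \<Rightarrow> real^'m \<Rightarrow> 'a" where
  "Param M i = inv_into (Dom M i) (Coord M i)"

definition transition :: "('a, 'i, 'm::finite) manifold \<Rightarrow> 'i \<Rightarrow> 'i \<Rightarrow> real^'m \<Rightarrow> real^'m" where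
  "transition M i j = Coord M j \<circ> Param M i"

definition smooth_manifold :: "('a, 'i, 'm::finite) manifold \<Rightarrow> bool" where
  "smooth_manifold M \<longleftrightarrow>
     Hausdorff_space (Top M) \<and> second_countable (Top M) \<and>
     topspace (Top M) = (\<Union>i\<in>Idx M. Dom M i) \<and>
     (\<forall>i\<in>Idx M. openin (Top M) (Dom M i) \<and> open (Img M i) \<and>
        homeomorphic_map (subtopology (Top M) (Dom M i)) (top_of_set (Img M i)) (Coord M i)) \<and>
     (\<forall>i\<in>Idx M. \<forall>j\<in>Idx M. smooth_on (Coord M i ` (Dom M i \<inter> Dom M j)) (transition M i j))"

definition in_chart :: "('a, 'i, 'm::finite) manifold \<Rightarrow> 'i \<Rightarrow> ('a \<Rightarrow> real) \<Rightarrow> real^'m \<Rightarrow> real" where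
  "in_chart M i u = u \<circ> Param M i"

definition smooth_function :: "('a, 'i, 'm::finite) manifold \<Rightarrow> ('a \<Rightarrow> real) \<Rightarrow> bool" where
  "smooth_function M u \<longleftrightarrow> (\<forall>i\<in>Idx M. smooth_on (Img M i) (in_chart M i u))"


section \<open>Semi-Riemannian metrics\<close>

text \<open>A \<open>(0,2)\<close>-tensor field is given by its component matrices \<open>g i y\<close> in each chart \<open>i\<close> at each
  coordinate point \<open>y\<close>, subject to the tensor transformation law.\<close>

type_synonym ('i, 'm) tensor2 = "'i \<Rightarrow> real^'m \<Rightarrow> real^'m^'m"

text \<open>There is an orthonormal basis (the columns of \<open>P\<close>) with exactly \<open>k\<close> timelike vectors.\<close>

definition has_index :: "real^'m^'m::finite \<Rightarrow> nat \<Rightarrow> bool" where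
  "has_index G k \<longleftrightarrow>
     (\<exists>(P :: real^'m^'m) s. invertible P \<and> (\<forall>i. s i = 1 \<or> s i = -1) \<and> card {i. s i = -1} = k \<and>
        transpose P ** G ** P = (\<chi> i j. if i = j then s i else 0))"

definition semi_riemannian_metric ::
  "('a, 'i, 'm::finite) manifold \<Rightarrow> ('i, 'm) tensor2 \<Rightarrow> bool" where
  "semi_riemannian_metric M g \<longleftrightarrow>
     (\<forall>i\<in>Idx M. \<forall>a b. smooth_on (Img M i) (\<lambda>y. g i y $ a $ b)) \<and>
     (\<forall>i\<in>Idx M. \<forall>j\<in>Idx M. \<forall>y\<in>Coord M i ` (Dom M i \<inter> Dom M j).
        let J = matrix (frechet_derivative (transition M i j) (at y))
        in g i y = transpose J ** g j (transition M i j y) ** J) \<and>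
     (\<forall>i\<in>Idx M. \<forall>y\<in>Img M i. transpose (g i y) = g i y \<and> invertible (g i y)) \<and>
     (\<exists>k. \<forall>i\<in>Idx M. \<forall>y\<in>Img M i. has_index (g i y) k)"

definition semi_riemannian_manifold ::
  "('a, 'i, 'm::finite) manifold \<Rightarrow> ('i, 'm) tensor2 \<Rightarrow> bool" where
  "semi_riemannian_manifold M g \<longleftrightarrow> smooth_manifold M \<and> semi_riemannian_metric M g"


section \<open>Curvature and Hessian in local coordinates\<close>

text \<open>\<open>G\<close> is the component matrix of the metric as a function of the coordinates of one chart.\<close>

definition christoffel :: "(real^'m \<Rightarrow> real^'m^'m) \<Rightarrow> 'm::finite \<Rightarrow> 'm \<Rightarrow> 'm \<Rightarrow> real^'m \<Rightarrow> real" where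
  "christoffel G k i j y =
     (1/2) * (\<Sum>l\<in>UNIV. matrix_inv (G y) $ k $ l *
        (partial i (\<lambda>z. G z $ j $ l) y + partial j (\<lambda>z. G z $ i $ l) y
          - partial l (\<lambda>z. G z $ i $ j) y))"

text \<open>Sign convention: \<open>R(\<partial>\<^sub>i, \<partial>\<^sub>j) \<partial>\<^sub>k = \<Sum>\<^sub>l riemann G l k i j \<cdot> \<partial>\<^sub>l\<close> with
  \<open>R(X,Y) = [\<nabla>\<^sub>X, \<nabla>\<^sub>Y] - \<nabla>\<^bsub>[X,Y]\<^esub>\<close>, so that round spheres have positive scalar curvature.\<close>

definition riemann ::
  "(real^'m \<Rightarrow> real^'m^'m) \<Rightarrow> 'm::finite \<Rightarrow> 'm \<Rightarrow> 'm \<Rightarrow> 'm \<Rightarrow> real^'m \<Rightarrow> real" where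
  "riemann G l k i j y =
     partial i (christoffel G l j k) y - partial j (christoffel G l i k) y
     + (\<Sum>p\<in>UNIV. christoffel G l i p y * christoffel G p j k y
                  - christoffel G l j p y * christoffel G p i k y)"

definition ricci :: "(real^'m \<Rightarrow> real^'m^'m) \<Rightarrow> 'm::finite \<Rightarrow> 'm \<Rightarrow> real^'m \<Rightarrow> real" where
  "ricci G j k y = (\<Sum>i\<in>UNIV. riemann G i k i j y)"

definition scalar_curvature :: "(real^'m::finite \<Rightarrow> real^'m^'m) \<Rightarrow> real^'m \<Rightarrow> real" where
  "scalar_curvature G y = (\<Sum>j\<in>UNIV. \<Sum>k\<in>UNIV. matrix_inv (G y) $ j $ k * ricci G j k y)"

definition hessian ::
  "(real^'m::finite \<Rightarrow> real^'m^'m) \<Rightarrow> (real^'m \<Rightarrow> real) \<Rightarrow> real^'m \<Rightarrow> real^'m^'m" where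
  "hessian G u y =
     (\<chi> i j. partial i (partial j u) y - (\<Sum>k\<in>UNIV. christoffel G k i j y * partial k u y))"

definition constant_scalar_curvature ::
  "('a, 'i, 'm::finite) manifold \<Rightarrow> ('i, 'm) tensor2 \<Rightarrow> real \<Rightarrow> bool" where
  "constant_scalar_curvature M g c \<longleftrightarrow>
     (\<forall>i\<in>Idx M. \<forall>y\<in>Img M i. scalar_curvature (g i) y = c)"

definition gradient_yamabe_soliton ::
  "('a, 'i, 'm::finite) manifold \<Rightarrow> ('i, 'm) tensor2 \<Rightarrow> ('a \<Rightarrow> real) \<Rightarrow> real \<Rightarrow> bool" where
  "gradient_yamabe_soliton M g u \<rho> \<longleftrightarrow>
     semi_riemannian_manifold M g \<and> smooth_function M u \<and>
     (\<forall>i\<in>Idx M. \<forall>y\<in>Img M i.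
        (scalar_curvature (g i) y - \<rho>) *\<^sub>R g i y = hessian (g i) (in_chart M i u) y)"


section \<open>Open subsets of coordinate space, products, warped metrics\<close>

definition open_submanifold :: "(real^'n) set \<Rightarrow> (real^'n, unit, 'n::finite) manifold" where
  "open_submanifold U = \<lparr>Top = top_of_set U, Idx = {()}, Dom = (\<lambda>_. U), Coord = (\<lambda>_ x. x)\<rparr>"

definition join :: "real^'n \<Rightarrow> real^'d \<Rightarrow> real^('n::finite + 'd::finite)" where
  "join x y = (\<chi> k. case k of Inl i \<Rightarrow> x $ i | Inr j \<Rightarrow> y $ j)"

definition left :: "real^('n::finite + 'd::finite) \<Rightarrow> real^'n" where
  "left z = (\<chi> i. z $ Inl i)"

definition right :: "real^('n::finite + 'd::finite) \<Rightarrow> real^'d" where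
  "right z = (\<chi> j. z $ Inr j)"

definition prod_manifold ::
  "('a, 'i, 'n::finite) manifold \<Rightarrow> ('b, 'j, 'd::finite) manifold
     \<Rightarrow> ('a \<times> 'b, 'i \<times> 'j, 'n + 'd) manifold" where
  "prod_manifold B F =
     \<lparr>Top = prod_topology (Top B) (Top F),
      Idx = Idx B \<times> Idx F,
      Dom = (\<lambda>(i, j). Dom B i \<times> Dom F j),
      Coord = (\<lambda>(i, j) (p, q). join (Coord B i p) (Coord F j q))\<rparr>"

text \<open>The metric \<open>\<pi>\<^sub>1\<^sup>* g\<^sub>B + (w \<circ> \<pi>\<^sub>1)\<^sup>2 \<pi>\<^sub>2\<^sup>* g\<^sub>F\<close> on the product, for a function \<open>w\<close> on the base.\<close>

definition warped_metric ::
  "('a, 'i, 'n::finite) manifold \<Rightarrow> ('i, 'n) tensor2 \<Rightarrow> ('a \<Rightarrow> real) \<Rightarrow> ('j, 'd::finite) tensor2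
     \<Rightarrow> ('i \<times> 'j, 'n + 'd) tensor2" where
  "warped_metric B gB w gF = (\<lambda>(i, j) z. \<chi> k l.
     (case (k, l) of
        (Inl a, Inl b) \<Rightarrow> gB i (left z) $ a $ b
      | (Inr a, Inr b) \<Rightarrow> (in_chart B i w (left z))\<^sup>2 * gF j (right z) $ a $ b
      | _ \<Rightarrow> 0))"

text \<open>The metric \<open>\<delta> / \<psi>\<^sup>2\<close>, where \<open>\<delta> = \<Sum>\<^sub>i \<epsilon>\<^sub>i dx\<^sub>i \<otimes> dx\<^sub>i\<close>, in the single identity chart.\<close>

definition conformal_flat_metric ::
  "real^'n::finite \<Rightarrow> (real^'n \<Rightarrow> real) \<Rightarrow> (unit, 'n) tensor2" where
  "conformal_flat_metric \<epsilon> \<psi> = (\<lambda>_ x. \<chi> i j. if i = j then \<epsilon> $ i / (\<psi> x)\<^sup>2 else 0)"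

definition pseudo_norm_sq :: "real^'n::finite \<Rightarrow> real^'n \<Rightarrow> real" where
  "pseudo_norm_sq \<epsilon> \<alpha> = (\<Sum>i\<in>UNIV. \<epsilon> $ i * (\<alpha> $ i)\<^sup>2)"

definition lin_form :: "real^'n::finite \<Rightarrow> real^'n \<Rightarrow> real" where
  "lin_form \<alpha> x = (\<Sum>i\<in>UNIV. \<alpha> $ i * x $ i)"

text \<open>The strip \<open>\<xi>\<^sup>-\<^sup>1((a,b))\<close> for \<open>\<xi> = lin_form \<alpha>\<close>; the endpoints may be infinite.\<close>

definition strip :: "real^'n::finite \<Rightarrow> ereal \<Rightarrow> ereal \<Rightarrow> (real^'n, unit, 'n) manifold" where
  "strip \<alpha> a b = open_submanifold (lin_form \<alpha> -` einterval a b)"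

definition soliton_metric ::
  "real^'n::finite \<Rightarrow> real^'n \<Rightarrow> ereal \<Rightarrow> ereal \<Rightarrow> (real \<Rightarrow> real) \<Rightarrow> (real \<Rightarrow> real)
     \<Rightarrow> ('j, 'd::finite) tensor2 \<Rightarrow> (unit \<times> 'j, 'n + 'd) tensor2" where
  "soliton_metric \<epsilon> \<alpha> a b \<phi> f gF =
     warped_metric (strip \<alpha> a b) (conformal_flat_metric \<epsilon> (\<lambda>x. \<phi> (lin_form \<alpha> x)))
       (\<lambda>x. f (lin_form \<alpha> x)) gF"

end

theory Submission
  imports Defs
begin

text \<open>The soliton equation \<open>(S - \<rho>) g = Hess u\<close> is compared block by block in a product chart, in which
  \<open>g\<close> is block diagonal: its base block is \<open>\<delta> / \<phi>\<^sup>2\<close> and its fibre block is \<open>f\<^sup>2 g\<^sub>F\<close>, where \<open>\<phi>\<close> and \<open>f\<close> are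
  evaluated at \<open>\<xi>\<close>. Write \<open>N = \<parallel>\<alpha>\<parallel>\<^sup>2\<close>.

  The Hessian of \<open>h(\<xi>)\<close> has base block
  \<open>\<alpha>\<^sub>i \<alpha>\<^sub>j (h'' + 2 \<phi>' h' / \<phi>) - \<epsilon>\<^sub>i \<delta>\<^sub>i\<^sub>j N \<phi>' h' / \<phi>\<close> and fibre block \<open>N \<phi>\<^sup>2 f f' h' g\<^sub>F\<close>
  (\<open>hessian_of_profile\<close>). Since \<open>\<alpha> \<noteq> 0\<close> and the base has dimension at least two, the rank one part
  \<open>\<alpha>\<^sub>i \<alpha>\<^sub>j\<close> can only be matched by a multiple of the diagonal matrix \<open>\<epsilon>\<close> if its coefficient
  vanishes; hence the tensor equation is equivalent to the three scalar equations
  \<open>h'' + 2 \<phi>' h' / \<phi> = 0\<close>, \<open>S - \<rho> = - N \<phi> \<phi>' h'\<close> and \<open>S - \<rho> = N \<phi>\<^sup>2 f' h' / f\<close>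
  (\<open>hessian_equation_splits\<close>).

  It remains to express \<open>S\<close> (\<open>scalar_curvature_G\<close>). All metric coefficients and Christoffel symbols
  are products of a function of \<open>\<xi>\<close> and a function on the fibre chart, so every partial derivative
  is given by one rule (\<open>partial_separated\<close>), and the Ricci tensor follows by contracting Kronecker
  symbols. The result is \<open>S = N [\<dots>] + \<lambda>\<^sub>F / f\<^sup>2\<close> with the bracket of the theorem, \<open>h\<close>-terms removed.
  If \<open>N \<noteq> 0\<close> the three equations are those of part (i); if \<open>N = 0\<close> the last two both become
  \<open>\<lambda>\<^sub>F / f\<^sup>2 = \<rho>\<close>, which is part (ii). Every value of \<open>\<xi>\<close> in the interval is attained because the linear
  form \<open>\<xi>\<close> is onto, and the fibre is nonempty, so equations along the manifold and along the interval
  are the same.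

  Being a soliton also includes that the warped product is a semi-Riemannian manifold and that the potential
  is smooth. This holds whatever the equations say (\<open>semi_riemannian_warped_metric\<close>,
  \<open>semi_riemannian_conformal_flat\<close>, \<open>smooth_function_prod_fst\<close>); all maps involved are built from smooth
  maps by sums, products, reciprocals and composition with linear maps, and these closure properties
  of \<open>smooth_on\<close> replace the general chain rule.
\<close>

section \<open>Derivatives depend only on local values\<close>

text \<open>Two functions that agree near a point have the same derivatives there, and if they have none, then the values
  picked by \<open>frechet_derivative\<close> still coincide. This lets closed formulas valid on a chart be
  differentiated although the component functions are arbitrary outside it.\<close>

lemma has_derivative_cong_open:
  assumes "open U" "x \<in> U" "\<And>y. y \<in> U \<Longrightarrow> f y = g y"
  shows "(f has_derivative D) (at x) \<longleftrightarrow> (g has_derivative D) (at x)"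
proof
  assume "(f has_derivative D) (at x)"
  then show "(g has_derivative D) (at x)"
    by (rule has_derivative_transform_within_open[OF _ assms])
next
  assume "(g has_derivative D) (at x)"
  then show "(f has_derivative D) (at x)"
    by (rule has_derivative_transform_within_open[OF _ assms(1,2) assms(3)[symmetric]])
qed

lemma frechet_derivative_cong_open:
  assumes "open U" "x \<in> U" "\<And>y. y \<in> U \<Longrightarrow> f y = g y"
  shows "frechet_derivative f (at x) = frechet_derivative g (at x)"
  unfolding frechet_derivative_def by (simp only: has_derivative_cong_open[OF assms])

section \<open>Coordinates on a product\<close>

lemma sum_UNIV_Plus:
  fixes g :: "'n::finite + 'd::finite \<Rightarrow> 'c::comm_monoid_add"
  shows "(\<Sum>k\<in>UNIV. g k) = (\<Sum>i\<in>UNIV. g (Inl i)) + (\<Sum>a\<in>UNIV. g (Inr a))"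
  unfolding UNIV_Plus_UNIV[symmetric] by (subst sum.Plus) auto

lemma left_join [simp]: "left (join x y) = x"
  and right_join [simp]: "right (join x y) = y"
  and join_left_right [simp]: "join (left z) (right z) = z"
  by (auto simp: left_def right_def join_def vec_eq_iff split: sum.splits)

lemma linear_left: "linear left" and linear_right: "linear right"
  by (auto intro!: linearI simp: left_def right_def vec_eq_iff)

lemma bounded_linear_left: "bounded_linear left"
  and bounded_linear_right: "bounded_linear right"
  by (simp_all add: linear_left linear_right linear_conv_bounded_linear[symmetric])

lemma linear_join: "linear (\<lambda>p. join (fst p) (snd p))"
  by (auto intro!: linearI simp: join_def vec_eq_iff split: sum.splits)

lemma bounded_linear_join: "bounded_linear (\<lambda>p. join (fst p) (snd p))"
  by (simp add: linear_join linear_conv_bounded_linear[symmetric])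

lemma linear_lin_form: "linear (lin_form \<alpha>)"
  by (auto intro!: linearI simp: lin_form_def algebra_simps sum.distrib sum_distrib_left)

lemma bounded_linear_lin_form: "bounded_linear (lin_form \<alpha>)"
  by (simp add: linear_lin_form linear_conv_bounded_linear[symmetric])

lemma left_axis [simp]: "left (axis (Inl i) c) = axis i c" "left (axis (Inr a) c) = 0"
  and right_axis [simp]: "right (axis (Inr a) c) = axis a c" "right (axis (Inl i) c) = 0"
  by (auto simp: left_def right_def axis_def vec_eq_iff)

lemma lin_form_axis [simp]: "lin_form \<alpha> (axis i c) = \<alpha> $ i * c"
proof -
  have "(\<lambda>j. \<alpha> $ j * (axis i c) $ j) = (\<lambda>j. if j = i then \<alpha> $ i * c else 0)"
    by (auto simp: axis_def)
  then have "lin_form \<alpha> (axis i c) = (\<Sum>j\<in>UNIV. if j = i then \<alpha> $ i * c else 0)"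
    unfolding lin_form_def by (rule arg_cong)
  then show ?thesis by simp
qed

lemma lin_form_zero [simp]: "lin_form \<alpha> 0 = 0"
  by (simp add: lin_form_def)

lemma partial_eqI: "(u has_derivative u') (at z) \<Longrightarrow> partial k u z = u' (axis k 1)"
  unfolding partial_def using frechet_derivative_at by metis

lemma partial_cong_open:
  assumes "open W" "z \<in> W" "\<And>w. w \<in> W \<Longrightarrow> u w = v w"
  shows "partial k u z = partial k v z"
  unfolding partial_def by (simp only: frechet_derivative_cong_open[OF assms])

lemma partial_const [simp]: "partial k (\<lambda>_. c) z = 0"
  by (simp add: partial_eqI[OF has_derivative_const])

text \<open>The only differentiation rule needed for the warped metric. The factor \<open>P\<close> is seen by base directions only,
  the factor \<open>Q\<close> by fibre directions only.\<close>

lemma partial_separated: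
  fixes z :: "real^('n::finite + 'd::finite)"
  assumes "(P has_real_derivative P') (at (lin_form \<alpha> (left z)))"
    and "Q differentiable at (right z)"
  shows "partial (Inl i) (\<lambda>w. P (lin_form \<alpha> (left w)) * Q (right w)) z = \<alpha> $ i * P' * Q (right z)"
    and "partial (Inr c) (\<lambda>w. P (lin_form \<alpha> (left w)) * Q (right w)) z
           = P (lin_form \<alpha> (left z)) * partial c Q (right z)"
proof -
  obtain Q' where Q': "(Q has_derivative Q') (at (right z))"
    using assms(2) by (auto simp: differentiable_def)
  have bl: "bounded_linear (\<lambda>w. lin_form \<alpha> (left w))"
    using bounded_linear_compose[OF bounded_linear_lin_form bounded_linear_left] .
  have 1: "((\<lambda>w. P (lin_form \<alpha> (left w))) has_derivative (\<lambda>v. P' * lin_form \<alpha> (left v))) (at z)"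
    using has_derivative_compose[OF bounded_linear_imp_has_derivative[OF bl]
        assms(1)[unfolded has_field_derivative_def]] by simp
  have 2: "((\<lambda>w. Q (right w)) has_derivative (\<lambda>v. Q' (right v))) (at z)"
    using has_derivative_compose[OF bounded_linear_imp_has_derivative[OF bounded_linear_right] Q'] .
  have Q0: "Q' 0 = 0" using has_derivative_bounded_linear[OF Q'] by (simp add: linear_simps)
  note 3 = partial_eqI[OF has_derivative_mult[OF 1 2]]
  show "partial (Inl i) (\<lambda>w. P (lin_form \<alpha> (left w)) * Q (right w)) z = \<alpha> $ i * P' * Q (right z)"
    by (simp add: 3 Q0)
  show "partial (Inr c) (\<lambda>w. P (lin_form \<alpha> (left w)) * Q (right w)) z
           = P (lin_form \<alpha> (left z)) * partial c Q (right z)"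
    by (simp add: 3 partial_eqI[OF Q'])
qed

section \<open>Block-diagonal and diagonal matrices\<close>

definition block_diag :: "real^'n^'n \<Rightarrow> real^'d^'d \<Rightarrow> real^('n::finite + 'd::finite)^('n + 'd)" where
  "block_diag A B = (\<chi> k l. case (k, l) of (Inl i, Inl j) \<Rightarrow> A $ i $ j
     | (Inr p, Inr q) \<Rightarrow> B $ p $ q | _ \<Rightarrow> 0)"

lemma block_diag_nth [simp]:
  "block_diag A B $ Inl i $ Inl j = A $ i $ j"
  "block_diag A B $ Inr p $ Inr q = B $ p $ q"
  "block_diag A B $ Inl i $ Inr q = 0"
  "block_diag A B $ Inr p $ Inl j = 0"
  by (simp_all add: block_diag_def)

lemma plus_vec_eq_iff: "(x = y) \<longleftrightarrow> (\<forall>i. x $ Inl i = y $ Inl i) \<and> (\<forall>p. x $ Inr p = y $ Inr p)"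
  unfolding vec_eq_iff by (metis sum.exhaust)

lemma block_diag_eq_iff: "block_diag A B = block_diag A' B' \<longleftrightarrow> A = A' \<and> B = B'"
  by (auto simp: plus_vec_eq_iff vec_eq_iff)

lemma block_diag_mult: "block_diag A B ** block_diag C D = block_diag (A ** C) (B ** D)"
  by (simp add: plus_vec_eq_iff matrix_matrix_mult_def sum_UNIV_Plus)

lemma block_diag_transpose: "transpose (block_diag A B) = block_diag (transpose A) (transpose B)"
  by (simp add: plus_vec_eq_iff transpose_def)

lemma block_diag_mat: "block_diag (mat c) (mat c) = mat c"
  by (auto simp: plus_vec_eq_iff mat_def)

lemma invertible_matrix_inv:
  assumes "invertible A"
  shows "A ** matrix_inv A = mat 1" "matrix_inv A ** A = mat 1"
  using assms someI_ex[of "\<lambda>A'. A ** A' = mat 1 \<and> A' ** A = mat 1"]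
  by (auto simp: invertible_def matrix_inv_def)

lemma matrix_inv_eqI:
  fixes A B :: "real^'k::finite^'k"
  assumes "A ** B = mat 1"
  shows "matrix_inv A = B" "invertible A"
proof -
  have BA: "B ** A = mat 1" using assms matrix_left_right_inverse by blast
  show inv: "invertible A" using assms BA by (auto simp: invertible_def)
  have "matrix_inv A = (matrix_inv A ** A) ** B"
    using assms by (metis matrix_mul_assoc matrix_mul_rid)
  also have "matrix_inv A ** A = mat 1" using invertible_matrix_inv[OF inv] by simp
  finally show "matrix_inv A = B" by simp
qed

lemma matrix_inv_block_diag:
  fixes A :: "real^'n::finite^'n" and B :: "real^'d::finite^'d"
  assumes "A ** A' = mat 1" "B ** B' = mat 1"
  shows "matrix_inv (block_diag A B) = block_diag A' B'" "invertible (block_diag A B)"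
  using assms matrix_inv_eqI[of "block_diag A B" "block_diag A' B'"]
  by (simp_all add: block_diag_mult block_diag_mat)

text \<open>Cramer's rule exhibits the entries of the inverse as quotients of determinants, hence as differentiable
  functions of the entries of the matrix. The Christoffel symbols of the fibre metric involve its inverse and have to be
  differentiated once more in the curvature.\<close>

lemma matrix_inv_nth_cramer:
  fixes A :: "real^'k::finite^'k"
  assumes "invertible A"
  shows "matrix_inv A $ i $ j = det (\<chi> p q. if q = i then (axis j 1 :: real^'k) $ p else A $ p $ q) / det A"
proof -
  have "A *v (matrix_inv A *v axis j 1) = axis j 1"
    using invertible_matrix_inv[OF assms] by (simp add: matrix_vector_mul_assoc)
  then have "matrix_inv A *v axis j 1
      = (\<chi> k. det (\<chi> p q. if q = k then (axis j 1 :: real^'k) $ p else A $ p $ q) / det A)"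
    using cramer[of A] assms invertible_det_nz by blast
  moreover have "matrix_inv A $ i $ j = (matrix_inv A *v axis j 1) $ i"
    by (simp add: matrix_vector_mul_component axis_def matrix_vector_mult_def if_distrib cong: if_cong)
  ultimately show ?thesis by simp
qed

lemma differentiable_prod_fun:
  fixes u :: "'i \<Rightarrow> 'a::real_normed_vector \<Rightarrow> real"
  assumes "finite I" "\<And>i. i \<in> I \<Longrightarrow> u i differentiable (at y within S)"
  shows "(\<lambda>x. \<Prod>i\<in>I. u i x) differentiable (at y within S)"
  using assms by (induction I rule: finite_induct) (auto intro: differentiable_mult)

lemma differentiable_det:
  fixes A :: "'a::real_normed_vector \<Rightarrow> real^'k::finite^'k"
  assumes "\<And>p q. (\<lambda>x. A x $ p $ q) differentiable (at y within S)"
  shows "(\<lambda>x. det (A x)) differentiable (at y within S)"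
proof -
  have "(\<lambda>x. of_int (sign p) * (\<Prod>i\<in>UNIV. A x $ i $ p i)) differentiable (at y within S)" for p
    by (rule differentiable_mult[OF differentiable_const differentiable_prod_fun]) (auto simp: assms)
  then show ?thesis
    unfolding det_def by (intro differentiable_sum) (auto simp: finite_permutations)
qed

lemma differentiable_matrix_inv:
  fixes A :: "'a::euclidean_space \<Rightarrow> real^'k::finite^'k"
  assumes "open V" "y \<in> V" "\<And>x. x \<in> V \<Longrightarrow> invertible (A x)"
    and d: "\<And>p q. (\<lambda>x. A x $ p $ q) differentiable at y"
  shows "(\<lambda>x. matrix_inv (A x) $ i $ j) differentiable at y"
proof -
  let ?B = "\<lambda>x. det (\<chi> p q. if q = i then (axis j 1 :: real^'k) $ p else A x $ p $ q) / det (A x)"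
  have "(\<lambda>x. (\<chi> p q. if q = i then (axis j 1 :: real^'k) $ p else A x $ p $ q) $ p $ q)
      differentiable at y" for p q
    by (cases "q = i") (auto simp: d)
  then have "?B differentiable at y"
    using assms invertible_det_nz[of "A y"]
    by (intro differentiable_divide differentiable_det d) auto
  then obtain D where "(?B has_derivative D) (at y)" by (auto simp: differentiable_def)
  then have "((\<lambda>x. matrix_inv (A x) $ i $ j) has_derivative D) (at y)"
    by (rule has_derivative_transform_within_open[OF _ assms(1,2)])
       (simp add: matrix_inv_nth_cramer assms(3))
  then show ?thesis by (auto simp: differentiable_def)
qed

definition diag_matrix :: "('k \<Rightarrow> real) \<Rightarrow> real^'k^'k::finite" where
  "diag_matrix v = (\<chi> i j. if i = j then v i else 0)"

lemma diag_matrix_nth [simp]: "diag_matrix v $ i $ j = (if i = j then v i else 0)"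
  by (simp add: diag_matrix_def)

lemma sum_if_mult:
  fixes u :: "'k::finite \<Rightarrow> real"
  shows "(\<Sum>l\<in>UNIV. (if k = l then c else 0) * u l) = c * u k"
  by (subst sum.cong[OF refl, of _ _ "\<lambda>l. if k = l then c * u k else 0"]) auto

lemma diag_matrix_mult: "diag_matrix u ** diag_matrix v = diag_matrix (\<lambda>i. u i * v i)"
  by (simp add: vec_eq_iff matrix_matrix_mult_def sum_if_mult)

lemma diag_matrix_1: "diag_matrix (\<lambda>_. c) = mat c"
  by (simp add: vec_eq_iff mat_def)

lemma transpose_diag_matrix [simp]: "transpose (diag_matrix v) = diag_matrix v"
  by (auto simp: vec_eq_iff transpose_def)

lemma scaleR_matrix_mult:
  fixes A :: "real^'k::finite^'m" and B :: "real^'l^'k"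
  shows "(c *\<^sub>R A) ** (d *\<^sub>R B) = (c * d) *\<^sub>R (A ** B)"
  by (simp add: vec_eq_iff matrix_matrix_mult_def sum_distrib_left ac_simps)

definition kronecker :: "'k \<Rightarrow> 'k \<Rightarrow> real" where
  "kronecker i j = (if i = j then 1 else 0)"

lemma sum_kronecker [simp]:
  fixes u :: "'k::finite \<Rightarrow> real"
  shows "(\<Sum>i\<in>UNIV. kronecker k i * u i) = u k" "(\<Sum>i\<in>UNIV. kronecker i k * u i) = u k"
    "(\<Sum>i\<in>UNIV. u i * kronecker k i) = u k" "(\<Sum>i\<in>UNIV. u i * kronecker i k) = u k"
    "(\<Sum>i\<in>(UNIV :: 'k set). kronecker i k) = 1"
  by (simp_all add: kronecker_def if_distrib if_distribR cong: if_cong)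

lemma kronecker_refl [simp]: "kronecker i i = 1" by (simp add: kronecker_def)

lemma kronecker_commute: "kronecker i j = kronecker j i" by (simp add: kronecker_def)

section \<open>Christoffel symbols of the warped metric in a chart\<close>

text \<open>The metric \<open>G\<close> in one product chart. Derivatives of \<open>\<phi>\<close> and \<open>f\<close> are separate functions to keep the formulas
  readable. \<open>\<gamma>\<close> is the fibre metric in a chart with image \<open>V\<close>. The form of \<open>G\<close> is prescribed over \<open>I\<close> and \<open>V\<close> only,
  because chart expressions are arbitrary outside the image of the chart.\<close>

locale local_soliton_metric =
  fixes \<epsilon> \<alpha> :: "real^'n::finite"
    and I :: "real set" and \<phi> \<phi>' \<phi>'' f f' f'' :: "real \<Rightarrow> real"
    and V :: "(real^'d::finite) set" and \<gamma> :: "real^'d \<Rightarrow> real^'d^'d"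
    and G :: "real^('n + 'd) \<Rightarrow> real^('n + 'd)^('n + 'd)"
  assumes open_I: "open I" and open_V: "open V"
    and \<epsilon>: "\<And>i. \<epsilon> $ i * \<epsilon> $ i = 1"
    and \<phi>_pos: "\<And>t. t \<in> I \<Longrightarrow> 0 < \<phi> t" and f_pos: "\<And>t. t \<in> I \<Longrightarrow> 0 < f t"
    and \<phi>_deriv: "\<And>t. t \<in> I \<Longrightarrow> (\<phi> has_real_derivative \<phi>' t) (at t)"
    and \<phi>'_deriv: "\<And>t. t \<in> I \<Longrightarrow> (\<phi>' has_real_derivative \<phi>'' t) (at t)"
    and f_deriv: "\<And>t. t \<in> I \<Longrightarrow> (f has_real_derivative f' t) (at t)"
    and f'_deriv: "\<And>t. t \<in> I \<Longrightarrow> (f' has_real_derivative f'' t) (at t)"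
    and \<gamma>_sym: "\<And>y. y \<in> V \<Longrightarrow> transpose (\<gamma> y) = \<gamma> y"
    and \<gamma>_inv: "\<And>y. y \<in> V \<Longrightarrow> invertible (\<gamma> y)"
    and \<gamma>_diff: "\<And>y p q. y \<in> V \<Longrightarrow> (\<lambda>w. \<gamma> w $ p $ q) differentiable at y"
    and d\<gamma>_diff: "\<And>y p q r. y \<in> V \<Longrightarrow> partial r (\<lambda>w. \<gamma> w $ p $ q) differentiable at y"
    and G: "\<And>z. lin_form \<alpha> (left z) \<in> I \<Longrightarrow> right z \<in> V \<Longrightarrow>
      G z = block_diag (diag_matrix (\<lambda>i. \<epsilon> $ i / (\<phi> (lin_form \<alpha> (left z)))\<^sup>2))
                       ((f (lin_form \<alpha> (left z)))\<^sup>2 *\<^sub>R \<gamma> (right z))"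
begin

definition W :: "(real^('n + 'd)) set" where
  "W = {z. lin_form \<alpha> (left z) \<in> I \<and> right z \<in> V}"

lemma open_W: "open W"
proof -
  have "W = (\<lambda>z. lin_form \<alpha> (left z)) -` I \<inter> right -` V" by (auto simp: W_def)
  moreover have "continuous_on UNIV (\<lambda>z::real^('n + 'd). lin_form \<alpha> (left z))"
    by (intro linear_continuous_on bounded_linear_compose[OF bounded_linear_lin_form bounded_linear_left])
  moreover have "continuous_on UNIV (right :: real^('n + 'd) \<Rightarrow> _)"
    by (intro linear_continuous_on bounded_linear_right)
  ultimately show ?thesis using open_I open_V
    by (metis open_Int open_UNIV open_vimage)
qed

abbreviation \<xi> :: "real^('n + 'd) \<Rightarrow> real" where "\<xi> z \<equiv> lin_form \<alpha> (left z)"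

lemma W_D: assumes "z \<in> W" shows "\<xi> z \<in> I" "right z \<in> V" "\<phi> (\<xi> z) \<noteq> 0" "f (\<xi> z) \<noteq> 0"
  using assms \<phi>_pos[of "\<xi> z"] f_pos[of "\<xi> z"] by (auto simp: W_def)

lemma \<epsilon>_nz: "\<epsilon> $ i \<noteq> 0" using \<epsilon>[of i] by auto

lemma \<gamma>_commute: "y \<in> V \<Longrightarrow> \<gamma> y $ p $ q = \<gamma> y $ q $ p"
  using \<gamma>_sym[of y] by (metis transpose_def vec_lambda_beta)

lemma matrix_inv_G:
  assumes "z \<in> W"
  shows "matrix_inv (G z) = block_diag (diag_matrix (\<lambda>i. \<epsilon> $ i * (\<phi> (\<xi> z))\<^sup>2))
           (inverse ((f (\<xi> z))\<^sup>2) *\<^sub>R matrix_inv (\<gamma> (right z)))" (is "_ = block_diag ?A' ?B'")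
    and "invertible (G z)"
proof -
  note w = W_D[OF assms]
  let ?A = "diag_matrix (\<lambda>i. \<epsilon> $ i / (\<phi> (\<xi> z))\<^sup>2)" and ?B = "(f (\<xi> z))\<^sup>2 *\<^sub>R \<gamma> (right z)"
  have "(\<lambda>i. \<epsilon> $ i / (\<phi> (\<xi> z))\<^sup>2 * (\<epsilon> $ i * (\<phi> (\<xi> z))\<^sup>2)) = (\<lambda>_. 1)"
    using w(3) \<epsilon> by simp
  then have A: "?A ** ?A' = mat 1" by (simp add: diag_matrix_mult diag_matrix_1)
  have B: "?B ** ?B' = mat 1"
    using w(4) by (simp add: scaleR_matrix_mult invertible_matrix_inv[OF \<gamma>_inv[OF w(2)]])
  show "matrix_inv (G z) = block_diag ?A' ?B'" "invertible (G z)"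
    unfolding G[OF w(1,2)] by (rule matrix_inv_block_diag[OF A B])+
qed

lemma partial_on_W:
  assumes "z \<in> W" "\<And>w. w \<in> W \<Longrightarrow> u w = P (\<xi> w) * Q (right w)"
    "(P has_real_derivative P') (at (\<xi> z))" "Q differentiable at (right z)"
  shows "partial (Inl i) u z = \<alpha> $ i * P' * Q (right z)"
    and "partial (Inr c) u z = P (\<xi> z) * partial c Q (right z)"
proof -
  have "partial k u z = partial k (\<lambda>w. P (\<xi> w) * Q (right w)) z" for k
    by (rule partial_cong_open[OF open_W assms(1,2)])
  then show "partial (Inl i) u z = \<alpha> $ i * P' * Q (right z)"
    "partial (Inr c) u z = P (\<xi> z) * partial c Q (right z)"
    by (simp_all only: partial_separated[OF assms(3,4)])
qed

lemma partial_G_base: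
  assumes "z \<in> W"
  shows "partial (Inl m) (\<lambda>w. G w $ Inl i $ Inl j) z
      = \<alpha> $ m * (- 2 * \<phi>' (\<xi> z) / \<phi> (\<xi> z) ^ 3) * (if i = j then \<epsilon> $ i else 0)"
    and "partial (Inr c) (\<lambda>w. G w $ Inl i $ Inl j) z = 0"
proof -
  let ?P = "\<lambda>t. 1 / (\<phi> t)\<^sup>2" and ?Q = "\<lambda>_ :: real^'d. if i = j then \<epsilon> $ i else 0"
  have eq: "G w $ Inl i $ Inl j = ?P (\<xi> w) * ?Q (right w)" if "w \<in> W" for w
    using W_D[OF that] by (simp add: G)
  have dP: "(?P has_real_derivative (- 2 * \<phi>' (\<xi> z) / \<phi> (\<xi> z) ^ 3)) (at (\<xi> z))"
    using W_D[OF assms]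
    by (auto intro!: derivative_eq_intros \<phi>_deriv simp: field_simps power2_eq_square power3_eq_cube)
  note * = partial_on_W[OF assms eq dP differentiable_const]
  show "partial (Inl m) (\<lambda>w. G w $ Inl i $ Inl j) z
      = \<alpha> $ m * (- 2 * \<phi>' (\<xi> z) / \<phi> (\<xi> z) ^ 3) * (if i = j then \<epsilon> $ i else 0)"
    by (rule *(1))
  show "partial (Inr c) (\<lambda>w. G w $ Inl i $ Inl j) z = 0"
    using *(2)[of c] by simp
qed

lemma partial_G_mixed:
  assumes "z \<in> W"
  shows "partial k (\<lambda>w. G w $ Inl i $ Inr p) z = 0" "partial k (\<lambda>w. G w $ Inr p $ Inl i) z = 0"
proof -
  have "partial k (\<lambda>w. G w $ Inl i $ Inr p) z = partial k (\<lambda>_. 0) z"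
    by (rule partial_cong_open[OF open_W assms]) (use W_D in \<open>simp add: G\<close>)
  then show "partial k (\<lambda>w. G w $ Inl i $ Inr p) z = 0" by simp
  have "partial k (\<lambda>w. G w $ Inr p $ Inl i) z = partial k (\<lambda>_. 0) z"
    by (rule partial_cong_open[OF open_W assms]) (use W_D in \<open>simp add: G\<close>)
  then show "partial k (\<lambda>w. G w $ Inr p $ Inl i) z = 0" by simp
qed

lemma partial_G_fibre:
  assumes "z \<in> W"
  shows "partial (Inl m) (\<lambda>w. G w $ Inr p $ Inr q) z
      = \<alpha> $ m * (2 * f (\<xi> z) * f' (\<xi> z)) * \<gamma> (right z) $ p $ q"
    and "partial (Inr c) (\<lambda>w. G w $ Inr p $ Inr q) z
      = (f (\<xi> z))\<^sup>2 * partial c (\<lambda>y. \<gamma> y $ p $ q) (right z)"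
proof -
  let ?P = "\<lambda>t. (f t)\<^sup>2" and ?Q = "\<lambda>y. \<gamma> y $ p $ q"
  have eq: "G w $ Inr p $ Inr q = ?P (\<xi> w) * ?Q (right w)" if "w \<in> W" for w
    using W_D[OF that] by (simp add: G)
  have dP: "(?P has_real_derivative (2 * f (\<xi> z) * f' (\<xi> z))) (at (\<xi> z))"
    using W_D[OF assms] by (auto intro!: derivative_eq_intros f_deriv)
  note * = partial_on_W[OF assms eq dP \<gamma>_diff[OF W_D(2)[OF assms]]]
  show "partial (Inl m) (\<lambda>w. G w $ Inr p $ Inr q) z
      = \<alpha> $ m * (2 * f (\<xi> z) * f' (\<xi> z)) * \<gamma> (right z) $ p $ q"
    by (rule *(1))
  show "partial (Inr c) (\<lambda>w. G w $ Inr p $ Inr q) z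
      = (f (\<xi> z))\<^sup>2 * partial c (\<lambda>y. \<gamma> y $ p $ q) (right z)"
    by (rule *(2))
qed

text \<open>The Christoffel symbols of a conformally flat metric are \<open>T\<close> multiplied by the negative logarithmic derivative of \<open>\<phi>\<close>:
  all dependence on the point is in that factor, so contractions of \<open>T\<close> are contractions of constants.\<close>

definition T :: "'n \<Rightarrow> 'n \<Rightarrow> 'n \<Rightarrow> real" where
  "T k i j = \<alpha> $ i * kronecker j k + \<alpha> $ j * kronecker i k - \<epsilon> $ i * \<epsilon> $ k * \<alpha> $ k * kronecker i j"

abbreviation "\<Gamma> \<equiv> christoffel G"

lemmas partial_G = partial_G_base partial_G_mixed partial_G_fibre

lemma christoffel_base_base_base:
  assumes "z \<in> W"
  shows "\<Gamma> (Inl k) (Inl i) (Inl j) z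
    = (- \<phi>' (\<xi> z) / \<phi> (\<xi> z)) * T k i j"
proof -
  let ?F = "(\<phi> (\<xi> z))\<^sup>2" and ?D = "- 2 * \<phi>' (\<xi> z) / \<phi> (\<xi> z) ^ 3"
  have FD: "?F * ?D = 2 * (- \<phi>' (\<xi> z) / \<phi> (\<xi> z))"
    using W_D(3)[OF assms] by (simp add: field_simps power2_eq_square power3_eq_cube)
  have "\<Gamma> (Inl k) (Inl i) (Inl j) z = (1/2) * (\<epsilon> $ k * ?F *
     (\<alpha> $ i * ?D * (if j = k then \<epsilon> $ j else 0) + \<alpha> $ j * ?D * (if i = k then \<epsilon> $ i else 0)
       - \<alpha> $ k * ?D * (if i = j then \<epsilon> $ i else 0)))"
    unfolding christoffel_def
    by (simp only: sum_UNIV_Plus matrix_inv_G(1)[OF assms] partial_G[OF assms] block_diag_nth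
        diag_matrix_nth sum_if_mult) simp
  also have "\<dots> = (1/2) * (?F * ?D) *
     (\<alpha> $ i * (\<epsilon> $ k * (if j = k then \<epsilon> $ j else 0)) + \<alpha> $ j * (\<epsilon> $ k * (if i = k then \<epsilon> $ i else 0))
       - \<alpha> $ k * (\<epsilon> $ k * (if i = j then \<epsilon> $ i else 0)))"
    by (simp only: algebra_simps)
  also have "\<epsilon> $ k * (if j = k then \<epsilon> $ j else 0) = kronecker j k"
    by (simp add: \<epsilon> kronecker_def)
  also have "\<epsilon> $ k * (if i = k then \<epsilon> $ i else 0) = kronecker i k"
    by (simp add: \<epsilon> kronecker_def)
  also have "\<epsilon> $ k * (if i = j then \<epsilon> $ i else 0) = \<epsilon> $ i * \<epsilon> $ k * kronecker i j"
    by (simp add: kronecker_def)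
  finally show ?thesis
    unfolding FD by (simp add: T_def algebra_simps)
qed

lemma christoffel_base_fibre_fibre:
  assumes "z \<in> W"
  shows "\<Gamma> (Inl k) (Inr p) (Inr q) z
    = (- ((\<phi> (\<xi> z))\<^sup>2 * f (\<xi> z) * f' (\<xi> z))) * (\<epsilon> $ k * \<alpha> $ k * \<gamma> (right z) $ p $ q)"
  unfolding christoffel_def
  by (simp only: sum_UNIV_Plus matrix_inv_G(1)[OF assms] partial_G[OF assms] block_diag_nth
        diag_matrix_nth sum_if_mult) simp

lemma christoffel_base_mixed:
  assumes "z \<in> W"
  shows "\<Gamma> (Inl k) (Inl i) (Inr q) z = 0" "\<Gamma> (Inl k) (Inr q) (Inl i) z = 0"
  using W_D[OF assms]
  by (auto simp: christoffel_def sum_UNIV_Plus matrix_inv_G(1)[OF assms] partial_G[OF assms])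

lemma \<gamma>_inverse_sum:
  assumes "y \<in> V" shows "(\<Sum>e\<in>UNIV. matrix_inv (\<gamma> y) $ c $ e * \<gamma> y $ e $ b) = kronecker c b"
  using arg_cong[OF invertible_matrix_inv(2)[OF \<gamma>_inv[OF assms]], of "\<lambda>A. A $ c $ b"]
  by (simp add: matrix_matrix_mult_def mat_def kronecker_def)

lemma christoffel_fibre_mixed:
  assumes "z \<in> W"
  shows "\<Gamma> (Inr c) (Inl i) (Inr q) z = (f' (\<xi> z) / f (\<xi> z)) * (\<alpha> $ i * kronecker c q)"
    and "\<Gamma> (Inr c) (Inr q) (Inl i) z = (f' (\<xi> z) / f (\<xi> z)) * (\<alpha> $ i * kronecker c q)"
proof -
  note w = W_D[OF assms]
  let ?y = "right z"
  have "(\<Sum>e\<in>UNIV. inverse ((f (\<xi> z))\<^sup>2) * matrix_inv (\<gamma> ?y) $ c $ e * (\<alpha> $ i * (2 * f (\<xi> z) * f' (\<xi> z)) * \<gamma> ?y $ q $ e))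
     = (\<Sum>e\<in>UNIV. (2 * (f' (\<xi> z) / f (\<xi> z)) * \<alpha> $ i) * (matrix_inv (\<gamma> ?y) $ c $ e * \<gamma> ?y $ e $ q))"
    using w by (intro sum.cong refl) (simp add: \<gamma>_commute[of ?y q] field_simps power2_eq_square)
  also have "\<dots> = (2 * (f' (\<xi> z) / f (\<xi> z)) * \<alpha> $ i) * kronecker c q"
    by (simp only: sum_distrib_left[symmetric] \<gamma>_inverse_sum[OF w(2)])
  finally have *: "(\<Sum>e\<in>UNIV. inverse ((f (\<xi> z))\<^sup>2) * matrix_inv (\<gamma> ?y) $ c $ e * (\<alpha> $ i * (2 * f (\<xi> z) * f' (\<xi> z)) * \<gamma> ?y $ q $ e))
     = (2 * (f' (\<xi> z) / f (\<xi> z)) * \<alpha> $ i) * kronecker c q" .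
  show "\<Gamma> (Inr c) (Inl i) (Inr q) z = (f' (\<xi> z) / f (\<xi> z)) * (\<alpha> $ i * kronecker c q)"
    "\<Gamma> (Inr c) (Inr q) (Inl i) z = (f' (\<xi> z) / f (\<xi> z)) * (\<alpha> $ i * kronecker c q)"
    using * by (simp_all add: christoffel_def sum_UNIV_Plus matrix_inv_G(1)[OF assms] partial_G[OF assms])
qed

lemma christoffel_fibre_base_base:
  assumes "z \<in> W"
  shows "\<Gamma> (Inr c) (Inl i) (Inl j) z = 0"
  by (simp add: christoffel_def sum_UNIV_Plus matrix_inv_G(1)[OF assms] partial_G[OF assms])

lemma christoffel_fibre_fibre_fibre:
  assumes "z \<in> W"
  shows "\<Gamma> (Inr c) (Inr p) (Inr q) z = christoffel \<gamma> c p q (right z)"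
proof -
  have *: "inverse ((f (\<xi> z))\<^sup>2) * m * ((f (\<xi> z))\<^sup>2 * x + (f (\<xi> z))\<^sup>2 * y - (f (\<xi> z))\<^sup>2 * v) = m * (x + y - v)" for m x y v
    using W_D[OF assms] by (simp add: field_simps)
  show ?thesis
    by (simp add: christoffel_def sum_UNIV_Plus matrix_inv_G(1)[OF assms] partial_G[OF assms] *)
qed

lemmas christoffel_components = christoffel_base_base_base christoffel_base_fibre_fibre christoffel_base_mixed christoffel_fibre_mixed
  christoffel_fibre_base_base christoffel_fibre_fibre_fibre

text \<open>The fibre components of \<open>\<Gamma>\<close> are differentiated once more inside the product chart. There the partial derivative of a
  pulled-back function is that of the original one if the latter is differentiable; otherwise both are arbitrary values.\<close>

lemma christoffel_\<gamma>_differentiable: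
  assumes "y \<in> V" shows "christoffel \<gamma> c p q differentiable at y"
proof -
  have "(\<lambda>y. matrix_inv (\<gamma> y) $ i $ j) differentiable at y" for i j
    by (rule differentiable_matrix_inv[OF open_V assms \<gamma>_inv \<gamma>_diff[OF assms]])
  then show ?thesis
    unfolding christoffel_def
    by (intro ballI differentiable_mult differentiable_const differentiable_sum differentiable_add
        differentiable_diff d\<gamma>_diff[OF assms]) auto
qed

section \<open>Curvature and Hessian of the warped metric in a chart\<close>

abbreviation N where "N \<equiv> pseudo_norm_sq \<epsilon> \<alpha>"

text \<open>The coefficient functions of the Christoffel symbols and their derivatives: \<open>c\<close> and \<open>w\<close> are the logarithmic derivatives of
  \<open>1 / \<phi>\<close> and \<open>f\<close>, and \<open>- v\<close> is the coefficient of the symbols with base upper index and fibre lower indices.\<close>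

definition c where "c t = - \<phi>' t / \<phi> t"
definition c' where "c' t = - (\<phi>'' t * \<phi> t - (\<phi>' t)\<^sup>2) / (\<phi> t)\<^sup>2"
definition w where "w t = f' t / f t"
definition w' where "w' t = (f'' t * f t - (f' t)\<^sup>2) / (f t)\<^sup>2"
definition v where "v t = (\<phi> t)\<^sup>2 * f t * f' t"
definition v' where "v' t = 2 * \<phi> t * \<phi>' t * f t * f' t + (\<phi> t)\<^sup>2 * ((f' t)\<^sup>2 + f t * f'' t)"

lemma coefficients_deriv:
  assumes "t \<in> I"
  shows "(c has_real_derivative c' t) (at t)" "(w has_real_derivative w' t) (at t)"
    "((\<lambda>t. - v t) has_real_derivative - v' t) (at t)"
  unfolding c_def[abs_def] w_def[abs_def] v_def[abs_def] c'_def w'_def v'_def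
  using \<phi>_pos[OF assms] f_pos[OF assms]
  by (auto intro!: derivative_eq_intros \<phi>_deriv[OF assms] \<phi>'_deriv[OF assms] f_deriv[OF assms] f'_deriv[OF assms]
      simp: field_simps power2_eq_square)

lemmas christoffel_coeffs = christoffel_components[folded c_def w_def v_def]

lemma partial_christoffel_base_base_base:
  assumes "z \<in> W"
  shows "partial (Inl m) (\<Gamma> (Inl k) (Inl i) (Inl j)) z = \<alpha> $ m * c' (\<xi> z) * T k i j"
  by (rule partial_on_W(1)[OF assms _ coefficients_deriv(1)[OF W_D(1)[OF assms]] differentiable_const])
     (rule christoffel_coeffs)

lemma partial_christoffel_base_fibre_fibre:
  assumes "z \<in> W"
  shows "partial (Inl m) (\<Gamma> (Inl k) (Inr p) (Inr q)) z
    = \<alpha> $ m * (- v' (\<xi> z)) * (\<epsilon> $ k * \<alpha> $ k * \<gamma> (right z) $ p $ q)"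
proof -
  have "(\<lambda>y. \<epsilon> $ k * \<alpha> $ k * \<gamma> y $ p $ q) differentiable at (right z)"
    by (intro differentiable_mult differentiable_const \<gamma>_diff W_D(2) assms)
  from partial_on_W(1)[OF assms _ coefficients_deriv(3)[OF W_D(1)[OF assms]] this] christoffel_coeffs(2)
  show ?thesis by blast
qed

lemma partial_christoffel_base_mixed:
  assumes "z \<in> W"
  shows "partial m (\<Gamma> (Inl k) (Inl i) (Inr q)) z = 0"
proof -
  have "partial m (\<Gamma> (Inl k) (Inl i) (Inr q)) z = partial m (\<lambda>_. 0) z"
    by (rule partial_cong_open[OF open_W assms]) (rule christoffel_base_mixed)
  then show ?thesis by simp
qed

lemma partial_christoffel_fibre_mixed:
  assumes "z \<in> W"
  shows "partial (Inl m) (\<Gamma> (Inr a) (Inr q) (Inl i)) z = \<alpha> $ m * w' (\<xi> z) * (\<alpha> $ i * kronecker a q)"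
  by (rule partial_on_W(1)[OF assms _ coefficients_deriv(2)[OF W_D(1)[OF assms]] differentiable_const])
     (rule christoffel_coeffs)

lemma partial_christoffel_fibre_base_base:
  assumes "z \<in> W"
  shows "partial m (\<Gamma> (Inr a) (Inl i) (Inl j)) z = 0"
proof -
  have "partial m (\<Gamma> (Inr a) (Inl i) (Inl j)) z = partial m (\<lambda>_. 0) z"
    by (rule partial_cong_open[OF open_W assms]) (rule christoffel_fibre_base_base)
  then show ?thesis by simp
qed

lemma partial_christoffel_fibre_fibre_fibre:
  assumes "z \<in> W"
  shows "partial (Inr r) (\<Gamma> (Inr a) (Inr p) (Inr q)) z = partial r (christoffel \<gamma> a p q) (right z)"
proof -
  have "((\<lambda>_. 1) has_real_derivative 0) (at (\<xi> z))" by simp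
  from partial_on_W(2)[OF assms _ this christoffel_\<gamma>_differentiable[OF W_D(2)[OF assms]]]
  show ?thesis by (simp add: christoffel_fibre_fibre_fibre)
qed

lemmas partial_christoffel = partial_christoffel_base_base_base partial_christoffel_base_fibre_fibre partial_christoffel_base_mixed
  partial_christoffel_fibre_mixed partial_christoffel_fibre_base_base partial_christoffel_fibre_fibre_fibre

lemma N_eq: "N = (\<Sum>i\<in>UNIV. \<epsilon> $ i * \<alpha> $ i * \<alpha> $ i)"
  by (simp add: pseudo_norm_sq_def power2_eq_square mult.assoc)

lemma sum_T_trace: "(\<Sum>i\<in>UNIV. T i i p) = real CARD('n) * \<alpha> $ p"
  by (simp add: T_def \<epsilon> sum.distrib sum_subtractf)

lemma sum_\<alpha>_T: "(\<Sum>i\<in>UNIV. \<alpha> $ i * T i j k) = 2 * \<alpha> $ j * \<alpha> $ k - \<epsilon> $ j * kronecker j k * N"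
proof -
  have "(\<Sum>i\<in>UNIV. \<alpha> $ i * T i j k) = (\<Sum>i\<in>UNIV. \<alpha> $ i * kronecker k i) * \<alpha> $ j
      + (\<Sum>i\<in>UNIV. \<alpha> $ i * kronecker j i) * \<alpha> $ k - \<epsilon> $ j * kronecker j k * N"
    unfolding T_def N_eq sum_distrib_left sum_distrib_right sum.distrib[symmetric] sum_subtractf[symmetric]
    by (intro sum.cong refl) (simp add: algebra_simps)
  then show ?thesis by simp
qed

text \<open>Contraction of \<open>T\<close> with an arbitrary vector in its last index; applied with \<open>u p = T p i k\<close> it reduces the quadratic
  contraction \<open>sum_T_T\<close> to linear ones.\<close>

lemma sum_T_left: "(\<Sum>p\<in>UNIV. T i j p * u p)
    = \<alpha> $ j * u i + kronecker i j * (\<Sum>p\<in>UNIV. \<alpha> $ p * u p) - \<epsilon> $ i * \<epsilon> $ j * \<alpha> $ i * u j"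
proof -
  have "(\<Sum>p\<in>UNIV. T i j p * u p) = \<alpha> $ j * (\<Sum>p\<in>UNIV. kronecker p i * u p)
      + kronecker i j * (\<Sum>p\<in>UNIV. \<alpha> $ p * u p) - \<epsilon> $ i * \<epsilon> $ j * \<alpha> $ i * (\<Sum>p\<in>UNIV. kronecker j p * u p)"
    unfolding T_def sum_distrib_left sum.distrib[symmetric] sum_subtractf[symmetric]
    by (intro sum.cong refl) (simp add: algebra_simps kronecker_commute[of j i])
  then show ?thesis by simp
qed

lemma sum_T_T: "(\<Sum>i\<in>UNIV. \<Sum>p\<in>UNIV. T i j p * T p i k)
    = (real CARD('n) + 2) * \<alpha> $ j * \<alpha> $ k - 2 * \<epsilon> $ j * kronecker j k * N"
proof -
  have 1: "(\<Sum>i\<in>UNIV. \<epsilon> $ i * \<epsilon> $ j * \<alpha> $ i * T j i k) = \<epsilon> $ j * kronecker j k * N"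
  proof -
    have "(\<Sum>i\<in>UNIV. \<epsilon> $ i * \<epsilon> $ j * \<alpha> $ i * T j i k)
       = \<epsilon> $ j * kronecker j k * N + \<epsilon> $ j * \<alpha> $ k * (\<Sum>i\<in>UNIV. \<epsilon> $ i * \<alpha> $ i * kronecker i j)
           - \<alpha> $ j * (\<Sum>i\<in>UNIV. (\<epsilon> $ i * \<epsilon> $ i) * (\<epsilon> $ j * \<epsilon> $ j) * \<alpha> $ i * kronecker i k)"
      unfolding T_def N_eq sum_distrib_left sum.distrib[symmetric] sum_subtractf[symmetric]
      by (intro sum.cong refl) (simp only: algebra_simps kronecker_commute[of k j])
    also have "\<dots> = \<epsilon> $ j * kronecker j k * N + (\<epsilon> $ j * \<epsilon> $ j) * \<alpha> $ k * \<alpha> $ j - \<alpha> $ j * \<alpha> $ k"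
      by (simp add: \<epsilon>)
    finally show ?thesis by (simp add: \<epsilon>)
  qed
  have "(\<Sum>i\<in>UNIV. \<Sum>p\<in>UNIV. T i j p * T p i k)
      = \<alpha> $ j * (\<Sum>i\<in>UNIV. T i i k) + (\<Sum>i\<in>UNIV. kronecker i j * (\<Sum>p\<in>UNIV. \<alpha> $ p * T p i k))
        - (\<Sum>i\<in>UNIV. \<epsilon> $ i * \<epsilon> $ j * \<alpha> $ i * T j i k)"
    unfolding sum_T_left by (simp add: sum.distrib sum_subtractf sum_distrib_left)
  then show ?thesis
    unfolding 1 sum_T_trace sum_kronecker sum_\<alpha>_T by (simp add: algebra_simps)
qed

text \<open>Separating the base and fibre values of the contracted index gives the Ricci tensor of \<open>\<delta> / \<phi>\<^sup>2\<close> (the terms in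
  \<open>c\<close> alone) and one identical contribution from each of the \<open>CARD('d)\<close> fibre directions. The contractions of \<open>T\<close> are kept
  unevaluated here.\<close>

lemma ricci_base:
  assumes "z \<in> W"
  defines "t \<equiv> \<xi> z"
  shows "ricci G (Inl j) (Inl k) z =
      c' t * ((\<Sum>i\<in>UNIV. \<alpha> $ i * T i j k) - (\<Sum>i\<in>UNIV. T i i k) * \<alpha> $ j)
    + (c t)\<^sup>2 * (real CARD('n) * (\<Sum>i\<in>UNIV. \<alpha> $ i * T i j k) - (\<Sum>i\<in>UNIV. \<Sum>p\<in>UNIV. T i j p * T p i k))
    + real CARD('d) * (- w' t * \<alpha> $ j * \<alpha> $ k + w t * c t * (\<Sum>i\<in>UNIV. \<alpha> $ i * T i j k) - (w t)\<^sup>2 * \<alpha> $ j * \<alpha> $ k)"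
proof -
  have base: "riemann G (Inl i) (Inl k) (Inl i) (Inl j) z
      = c' t * (\<alpha> $ i * T i j k - T i i k * \<alpha> $ j)
       + (c t)\<^sup>2 * ((\<Sum>p\<in>UNIV. T i i p * T p j k) - (\<Sum>p\<in>UNIV. T i j p * T p i k))" for i
    by (simp add: riemann_def sum_UNIV_Plus partial_christoffel[OF assms(1)] christoffel_coeffs[OF assms(1)] t_def[symmetric]
        sum_distrib_left sum_subtractf algebra_simps power2_eq_square)
  have fibre: "riemann G (Inr a) (Inl k) (Inr a) (Inl j) z
      = - w' t * \<alpha> $ j * \<alpha> $ k + w t * c t * (\<Sum>i\<in>UNIV. \<alpha> $ i * T i j k) - (w t)\<^sup>2 * \<alpha> $ j * \<alpha> $ k" for a
  proof -
    have "(\<Sum>p\<in>UNIV. w t * (\<alpha> $ j * kronecker a p) * (w t * (\<alpha> $ k * kronecker p a)))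
      = (w t)\<^sup>2 * \<alpha> $ j * \<alpha> $ k * (\<Sum>p\<in>UNIV. kronecker a p * kronecker p a)"
      unfolding sum_distrib_left by (intro sum.cong refl) (simp add: power2_eq_square)
    then show ?thesis
      by (simp add: riemann_def sum_UNIV_Plus partial_christoffel[OF assms(1)] christoffel_coeffs[OF assms(1)] t_def[symmetric]
        sum_distrib_left sum_subtractf sum_negf ac_simps)
  qed
  have "(\<Sum>i\<in>UNIV. \<Sum>p\<in>UNIV. T i i p * T p j k) = real CARD('n) * (\<Sum>i\<in>UNIV. \<alpha> $ i * T i j k)"
    by (subst sum.swap) (simp add: sum_distrib_right[symmetric] sum_T_trace sum_distrib_left mult.assoc)
  then show ?thesis
    by (simp add: ricci_def sum_UNIV_Plus base fibre sum.distrib sum_subtractf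
        sum_distrib_left[symmetric] sum_distrib_right[symmetric])
qed

text \<open>Besides the intrinsic Ricci tensor of the fibre, every term is a multiple of \<open>N \<gamma>\<close>: the symbol with a base upper
  index contributes \<open>\<epsilon>\<^sub>i \<alpha>\<^sub>i\<close>, and what it is contracted with (a derivative along the base, a trace of \<open>T\<close>, or a symbol
  mixing base and fibre) contributes a second \<open>\<alpha>\<^sub>i\<close>.\<close>

lemma ricci_fibre:
  assumes "z \<in> W"
  defines "t \<equiv> \<xi> z"
  shows "ricci G (Inr p) (Inr q) z = ricci \<gamma> p q (right z)
    + N * (- v' t - real CARD('n) * c t * v t + 2 * v t * w t - real CARD('d) * w t * v t) * \<gamma> (right z) $ p $ q"
proof -
  let ?g = "\<gamma> (right z)"
  have base: "riemann G (Inl i) (Inr q) (Inl i) (Inr p) z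
      = (\<epsilon> $ i * \<alpha> $ i * \<alpha> $ i) * ((- v' t + v t * w t) * ?g $ p $ q)
       - (\<Sum>l\<in>UNIV. T i i l * (c t * v t * \<epsilon> $ l * \<alpha> $ l * ?g $ p $ q))" for i
  proof -
    have "(\<Sum>r\<in>UNIV. v t * (\<epsilon> $ i * \<alpha> $ i * ?g $ p $ r) * (w t * (\<alpha> $ i * kronecker r q)))
      = v t * w t * \<epsilon> $ i * \<alpha> $ i * \<alpha> $ i * (\<Sum>r\<in>UNIV. ?g $ p $ r * kronecker r q)"
      unfolding sum_distrib_left by (intro sum.cong refl) simp
    then show ?thesis
      by (simp add: riemann_def sum_UNIV_Plus partial_christoffel[OF assms(1)] christoffel_coeffs[OF assms(1)] t_def[symmetric]
        sum_negf algebra_simps)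
  qed
  have fibre: "riemann G (Inr a) (Inr q) (Inr a) (Inr p) z
      = riemann \<gamma> a q a p (right z) - w t * v t * N * ?g $ p $ q + (w t * v t * N) * (kronecker a p * ?g $ a $ q)" for a
  proof -
    have 1: "(\<Sum>l\<in>UNIV. w t * \<alpha> $ l * (v t * (\<epsilon> $ l * \<alpha> $ l * x))) = w t * v t * N * x" for x
      unfolding N_eq sum_distrib_left sum_distrib_right by (intro sum.cong refl) simp
    have "(\<Sum>l\<in>UNIV. w t * (\<alpha> $ l * kronecker a p) * (v t * (\<epsilon> $ l * \<alpha> $ l * ?g $ a $ q)))
       = w t * v t * N * (kronecker a p * ?g $ a $ q)"
      unfolding N_eq sum_distrib_left sum_distrib_right by (intro sum.cong refl) simp
    with 1 show ?thesis
      by (simp add: riemann_def sum_UNIV_Plus partial_christoffel[OF assms(1)] christoffel_coeffs[OF assms(1)] t_def[symmetric]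
        sum_negf sum_subtractf)
  qed
  have "(\<Sum>i\<in>UNIV. \<Sum>l\<in>UNIV. T i i l * (c t * v t * \<epsilon> $ l * \<alpha> $ l * ?g $ p $ q))
      = (\<Sum>l\<in>UNIV. (\<Sum>i\<in>UNIV. T i i l) * (c t * v t * \<epsilon> $ l * \<alpha> $ l * ?g $ p $ q))"
    unfolding sum_distrib_right by (rule sum.swap)
  also have "\<dots> = real CARD('n) * c t * v t * N * ?g $ p $ q"
    unfolding sum_T_trace N_eq sum_distrib_left sum_distrib_right by (intro sum.cong refl) simp
  finally have 2: "(\<Sum>i\<in>UNIV. \<Sum>l\<in>UNIV. T i i l * (c t * v t * \<epsilon> $ l * \<alpha> $ l * ?g $ p $ q))
      = real CARD('n) * c t * v t * N * ?g $ p $ q" .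
  show ?thesis
    unfolding ricci_def sum_UNIV_Plus base fibre sum.distrib sum_subtractf
      sum_distrib_left[symmetric] sum_distrib_right[symmetric] N_eq[symmetric] 2 sum_kronecker
    by (simp add: algebra_simps)
qed

lemma \<gamma>_trace:
  assumes "y \<in> V" shows "(\<Sum>p\<in>UNIV. \<Sum>q\<in>UNIV. matrix_inv (\<gamma> y) $ p $ q * \<gamma> y $ p $ q) = real CARD('d)"
proof -
  have "(\<Sum>p\<in>UNIV. \<Sum>q\<in>UNIV. matrix_inv (\<gamma> y) $ p $ q * \<gamma> y $ p $ q)
      = (\<Sum>p\<in>UNIV. \<Sum>q\<in>UNIV. matrix_inv (\<gamma> y) $ p $ q * \<gamma> y $ q $ p)"
    using \<gamma>_commute[OF assms] by (intro sum.cong refl) metis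
  then show ?thesis by (simp add: \<gamma>_inverse_sum[OF assms])
qed

text \<open>Tracing the base block of the Ricci tensor uses \<open>\<Sum>\<^sub>j \<epsilon>\<^sub>j \<alpha>\<^sub>j \<alpha>\<^sub>j = N\<close> and \<open>\<Sum>\<^sub>j \<epsilon>\<^sub>j \<epsilon>\<^sub>j = n\<close>, tracing the fibre block uses
  that \<open>\<gamma>\<close> contracted with its inverse is \<open>d\<close>. The first summand contains both the curvature of the base and the
  warping terms \<open>- 2 d (\<Delta> f) / f\<close> and \<open>- d (d - 1) |\<nabla>f|\<^sup>2 / f\<^sup>2\<close>.\<close>

lemma scalar_curvature_G:
  assumes "z \<in> W"
  defines "t \<equiv> \<xi> z"
  shows "scalar_curvature G z =
    N * ((real CARD('n) - 1) * (2 * \<phi> t * \<phi>'' t - real CARD('n) * (\<phi>' t)\<^sup>2)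
      - 2 * real CARD('d) / f t * ((\<phi> t)\<^sup>2 * f'' t - (real CARD('n) - 2) * \<phi> t * \<phi>' t * f' t)
      - real CARD('d) * (real CARD('d) - 1) / (f t)\<^sup>2 * (\<phi> t)\<^sup>2 * (f' t)\<^sup>2)
    + scalar_curvature \<gamma> (right z) / (f t)\<^sup>2"
proof -
  let ?n = "real CARD('n)" and ?d = "real CARD('d)" and ?y = "right z"
  note W = W_D[OF assms(1), folded t_def]
  have "scalar_curvature G z = (\<Sum>j\<in>UNIV. \<epsilon> $ j * (\<phi> t)\<^sup>2 * ricci G (Inl j) (Inl j) z)
      + (\<Sum>p\<in>UNIV. \<Sum>q\<in>UNIV. inverse ((f t)\<^sup>2) * matrix_inv (\<gamma> ?y) $ p $ q * ricci G (Inr p) (Inr q) z)"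
    unfolding scalar_curvature_def
    by (simp add: sum_UNIV_Plus matrix_inv_G(1)[OF assms(1)] t_def[symmetric] sum_if_mult)
  also have "(\<Sum>j\<in>UNIV. \<epsilon> $ j * (\<phi> t)\<^sup>2 * ricci G (Inl j) (Inl j) z) =
     (\<phi> t)\<^sup>2 * N * (c' t * (2 - 2 * ?n) + (c t)\<^sup>2 * ((?n - 1) * (2 - ?n)) + ?d * (- w' t + w t * c t * (2 - ?n) - (w t)\<^sup>2))"
  proof -
    let ?X = "c' t * (2 - ?n) + (c t)\<^sup>2 * (?n - 2) + ?d * (- w' t + 2 * w t * c t - (w t)\<^sup>2)"
    let ?Y = "- c' t + (c t)\<^sup>2 * (2 - ?n) - ?d * w t * c t"
    \<comment> \<open>\<open>?X\<close> and \<open>?Y\<close> are the coefficients of \<open>\<alpha>\<^sub>j \<alpha>\<^sub>k\<close> and \<open>\<epsilon>\<^sub>j \<delta>\<^sub>j\<^sub>k N\<close> in the base block of the Ricci tensor.\<close>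
    have "\<epsilon> $ j * (\<phi> t)\<^sup>2 * ricci G (Inl j) (Inl j) z
        = (\<phi> t)\<^sup>2 * ?X * (\<epsilon> $ j * \<alpha> $ j * \<alpha> $ j) + (\<phi> t)\<^sup>2 * N * ?Y * (\<epsilon> $ j * \<epsilon> $ j)" for j
      unfolding ricci_base[OF assms(1), folded t_def] sum_\<alpha>_T sum_T_trace sum_T_T kronecker_refl
      by algebra
    then have "(\<Sum>j\<in>UNIV. \<epsilon> $ j * (\<phi> t)\<^sup>2 * ricci G (Inl j) (Inl j) z)
        = (\<phi> t)\<^sup>2 * ?X * N + (\<phi> t)\<^sup>2 * N * ?Y * ?n"
      by (simp add: sum.distrib sum_distrib_left[symmetric] N_eq[symmetric] \<epsilon>)
    then show ?thesis by algebra
  qed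
  also have "(\<Sum>p\<in>UNIV. \<Sum>q\<in>UNIV. inverse ((f t)\<^sup>2) * matrix_inv (\<gamma> ?y) $ p $ q * ricci G (Inr p) (Inr q) z)
     = inverse ((f t)\<^sup>2) * (scalar_curvature \<gamma> ?y + N * (- v' t - ?n * c t * v t + 2 * v t * w t - ?d * w t * v t) * ?d)"
  proof -
    let ?K = "N * (- v' t - ?n * c t * v t + 2 * v t * w t - ?d * w t * v t)"
    have "(\<Sum>p\<in>UNIV. \<Sum>q\<in>UNIV. inverse ((f t)\<^sup>2) * matrix_inv (\<gamma> ?y) $ p $ q * ricci G (Inr p) (Inr q) z)
      = inverse ((f t)\<^sup>2) * (scalar_curvature \<gamma> ?y
          + ?K * (\<Sum>p\<in>UNIV. \<Sum>q\<in>UNIV. matrix_inv (\<gamma> ?y) $ p $ q * \<gamma> ?y $ p $ q))"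
      unfolding ricci_fibre[OF assms(1), folded t_def] scalar_curvature_def
        sum_distrib_left sum.distrib[symmetric]
      by (intro sum.cong refl) (simp only: algebra_simps)
    then show ?thesis unfolding \<gamma>_trace[OF W(2)] .
  qed
  \<comment> \<open>The powers of \<open>\<phi>\<close> and \<open>1 / f\<close> are grouped with the coefficient functions whose denominators they clear.\<close>
  finally have S: "scalar_curvature G z = N * ((2 - 2 * ?n) * ((\<phi> t)\<^sup>2 * c' t) + (?n - 1) * (2 - ?n) * ((\<phi> t)\<^sup>2 * (c t)\<^sup>2)
        + ?d * (- ((\<phi> t)\<^sup>2 * w' t) + w t * ((\<phi> t)\<^sup>2 * c t) * (2 - ?n) - (\<phi> t)\<^sup>2 * (w t)\<^sup>2)
        + ?d * (- (inverse ((f t)\<^sup>2) * v' t) - ?n * c t * (inverse ((f t)\<^sup>2) * v t)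
            + 2 * w t * (inverse ((f t)\<^sup>2) * v t) - ?d * w t * (inverse ((f t)\<^sup>2) * v t)))
      + inverse ((f t)\<^sup>2) * scalar_curvature \<gamma> ?y"
    by (simp only: algebra_simps)
  have "(\<phi> t)\<^sup>2 * c' t = (\<phi>' t)\<^sup>2 - \<phi> t * \<phi>'' t" "(\<phi> t)\<^sup>2 * (c t)\<^sup>2 = (\<phi>' t)\<^sup>2"
    "(\<phi> t)\<^sup>2 * c t = - (\<phi> t * \<phi>' t)"
    using W(3) by (simp_all add: c_def c'_def field_simps power2_eq_square)
  moreover have "w' t = f'' t / f t - (w t)\<^sup>2" "inverse ((f t)\<^sup>2) * v t = (\<phi> t)\<^sup>2 * w t"
    "inverse ((f t)\<^sup>2) * v' t = 2 * \<phi> t * \<phi>' t * w t + (\<phi> t)\<^sup>2 * ((w t)\<^sup>2 + f'' t / f t)"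
    using W(4) by (simp_all add: w_def w'_def v_def v'_def field_simps power2_eq_square)
  moreover have "?n * c t * ((\<phi> t)\<^sup>2 * w t) = - (?n * (\<phi> t * \<phi>' t) * w t)"
    using W(3) by (simp add: c_def power2_eq_square)
  moreover have "2 * ?d / f t * ((\<phi> t)\<^sup>2 * f'' t - (?n - 2) * \<phi> t * \<phi>' t * f' t)
      = 2 * ?d * ((\<phi> t)\<^sup>2 * (f'' t / f t) - (?n - 2) * \<phi> t * \<phi>' t * w t)"
    "?d * (?d - 1) / (f t)\<^sup>2 * (\<phi> t)\<^sup>2 * (f' t)\<^sup>2 = ?d * (?d - 1) * (\<phi> t)\<^sup>2 * (w t)\<^sup>2"
    "x / (f t)\<^sup>2 = inverse ((f t)\<^sup>2) * x" for x
    using W(4) by (simp_all add: w_def field_simps power2_eq_square)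
  ultimately show ?thesis
    unfolding S by (simp only:) (simp add: algebra_simps power2_eq_square)
qed

text \<open>The fibre block need not vanish although the function is constant along the fibres: it comes from the symbols \<open>\<Gamma>\<close> with base upper
  index, that is, from the second fundamental form of the fibres.\<close>

lemma hessian_of_profile:
  assumes "z \<in> W"
    and u: "\<And>z. z \<in> W \<Longrightarrow> u z = h (\<xi> z)"
    and h: "\<And>t. t \<in> I \<Longrightarrow> (h has_real_derivative h' t) (at t)"
    and h': "\<And>t. t \<in> I \<Longrightarrow> (h' has_real_derivative h'' t) (at t)"
  defines "t \<equiv> \<xi> z"
  shows "hessian G u z = block_diag
    (\<chi> i j. \<alpha> $ i * \<alpha> $ j * (h'' t + 2 * (\<phi>' t * h' t / \<phi> t)) - \<epsilon> $ i * kronecker i j * (\<phi>' t * h' t / \<phi> t * N))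
    ((N * (\<phi> t)\<^sup>2 * f t * f' t * h' t) *\<^sub>R \<gamma> (right z))"
proof -
  have du: "partial (Inl i) u x = \<alpha> $ i * h' (\<xi> x)" "partial (Inr p) u x = 0" if "x \<in> W" for i p x
  proof -
    have eq: "u y = h (\<xi> y) * 1" if "y \<in> W" for y using u[OF that] by simp
    note * = partial_on_W[OF that eq h[OF W_D(1)[OF that]] differentiable_const]
    show "partial (Inl i) u x = \<alpha> $ i * h' (\<xi> x)" using *(1)[of i] by simp
    show "partial (Inr p) u x = 0" using *(2)[of p] by simp
  qed
  have ddu: "partial (Inl i) (partial (Inl j) u) z = \<alpha> $ i * \<alpha> $ j * h'' t"
    "partial (Inr p) (partial (Inl j) u) z = 0" for i j p
  proof -
    have eq: "partial (Inl j) u y = h' (\<xi> y) * \<alpha> $ j" if "y \<in> W" for y using du(1)[OF that] by simp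
    note * = partial_on_W[OF assms(1) eq h'[OF W_D(1)[OF assms(1)]] differentiable_const]
    show "partial (Inl i) (partial (Inl j) u) z = \<alpha> $ i * \<alpha> $ j * h'' t"
      using *(1)[of i] by (simp add: t_def)
    show "partial (Inr p) (partial (Inl j) u) z = 0" using *(2)[of p] by simp
  qed
  have ddu0: "partial k (partial (Inr p) u) z = 0" for k p
  proof -
    have "partial k (partial (Inr p) u) z = partial k (\<lambda>_. 0) z"
      by (rule partial_cong_open[OF open_W assms(1)]) (rule du(2))
    then show ?thesis by simp
  qed
  have 1: "(\<Sum>k\<in>UNIV. c t * T k i j * (\<alpha> $ k * h' t))
      = c t * h' t * (2 * \<alpha> $ i * \<alpha> $ j - \<epsilon> $ i * kronecker i j * N)" for i j
    unfolding sum_\<alpha>_T[symmetric] sum_distrib_left by (intro sum.cong refl) simp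
  have 2: "(\<Sum>k\<in>UNIV. v t * (\<epsilon> $ k * \<alpha> $ k * x) * (\<alpha> $ k * h' t)) = v t * N * x * h' t" for x
    unfolding N_eq sum_distrib_left sum_distrib_right by (intro sum.cong refl) simp
  show ?thesis
    unfolding plus_vec_eq_iff
    by (auto simp: hessian_def sum_UNIV_Plus ddu ddu0 du[OF assms(1)] christoffel_coeffs[OF assms(1)] t_def[symmetric] 1 2 sum_negf)
       (simp_all add: c_def v_def algebra_simps)
qed

end

section \<open>Smooth functions on open sets\<close>

lemma differentiable_on_openD:
  "open U \<Longrightarrow> f differentiable_on U \<Longrightarrow> x \<in> U \<Longrightarrow> (f has_derivative frechet_derivative f (at x)) (at x)"
  using differentiable_on_eq_differentiable_at frechet_derivative_works by blast

lemma differentiable_on_openI: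
  "(\<And>x. x \<in> U \<Longrightarrow> (f has_derivative D x) (at x)) \<Longrightarrow> f differentiable_on U"
  by (meson differentiableI differentiable_at_imp_differentiable_on)

lemma Ck_on_cong:
  assumes "open U" "\<And>x. x \<in> U \<Longrightarrow> f x = g x"
  shows "Ck_on k U f \<longleftrightarrow> Ck_on k U g"
  using assms(2)
proof (induction k arbitrary: f g)
  case 0
  then show ?case by (simp cong: continuous_on_cong)
next
  case (Suc k)
  have "f differentiable_on U \<longleftrightarrow> g differentiable_on U"
    using Suc.prems by (auto simp: differentiable_on_eq_differentiable_at[OF assms(1)] differentiable_def
        has_derivative_cong_open[OF assms(1) _ Suc.prems])
  moreover have "Ck_on k U (\<lambda>x. frechet_derivative f (at x) b) \<longleftrightarrow> Ck_on k U (\<lambda>x. frechet_derivative g (at x) b)" for b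
    by (rule Suc.IH) (simp add: frechet_derivative_cong_open[OF assms(1) _ Suc.prems])
  ultimately show ?case by simp
qed

text \<open>For proving closure properties by induction on the order: any explicit derivative may be
  used in place of the Frechet derivative, provided that its values on basis vectors are again of class \<open>C\<^sup>k\<close>.\<close>

lemma Ck_on_SucI:
  assumes "open U" "\<And>x. x \<in> U \<Longrightarrow> (f has_derivative D x) (at x)"
    "\<And>b. b \<in> Basis \<Longrightarrow> Ck_on k U (\<lambda>x. D x b)"
  shows "Ck_on (Suc k) U f"
proof -
  have "Ck_on k U (\<lambda>x. frechet_derivative f (at x) b) \<longleftrightarrow> Ck_on k U (\<lambda>x. D x b)" for b
    by (rule Ck_on_cong[OF assms(1)]) (use assms(2) frechet_derivative_at in metis)
  then show ?thesis using assms differentiable_on_openI[OF assms(2)] by simp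
qed

lemma Ck_on_SucD: "Ck_on (Suc k) U f \<Longrightarrow> Ck_on k U f"
  by (induction k arbitrary: f) (auto intro: differentiable_imp_continuous_on)

lemma Ck_on_subset: "Ck_on k U f \<Longrightarrow> V \<subseteq> U \<Longrightarrow> Ck_on k V f"
  by (induction k arbitrary: f) (auto intro: continuous_on_subset differentiable_on_subset)

lemma Ck_on_const: "Ck_on k U (\<lambda>_. c)"
  by (induction k arbitrary: c) (simp_all add: frechet_derivative_const)

lemma Ck_on_bounded_linear:
  assumes "bounded_linear L" "open U" shows "Ck_on k U L"
proof (cases k)
  case 0
  then show ?thesis using assms linear_continuous_on by simp
next
  case (Suc m)
  have "Ck_on (Suc m) U L"
    by (rule Ck_on_SucI[OF assms(2) bounded_linear_imp_has_derivative[OF assms(1)]])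
       (rule Ck_on_const)
  then show ?thesis using Suc by simp
qed

lemma Ck_on_compose_bounded_linear:
  assumes "bounded_linear L" "open U" "Ck_on k U f"
  shows "Ck_on k U (\<lambda>x. L (f x))"
  using assms(3)
proof (induction k arbitrary: f)
  case 0
  then show ?case using bounded_linear.continuous_on[OF assms(1)] by simp
next
  case (Suc k)
  have D: "((\<lambda>x. L (f x)) has_derivative (\<lambda>b. L (frechet_derivative f (at x) b))) (at x)" if "x \<in> U" for x
    using Suc.prems that by (intro bounded_linear.has_derivative[OF assms(1)] differentiable_on_openD[OF assms(2)]) auto
  show ?case
    by (rule Ck_on_SucI[OF assms(2) D]) (use Suc in auto)
qed

lemma Ck_on_add:
  assumes "open U" "Ck_on k U f" "Ck_on k U g"
  shows "Ck_on k U (\<lambda>x. f x + g x)"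
  using assms(2,3)
proof (induction k arbitrary: f g)
  case 0
  then show ?case by (simp add: continuous_on_add)
next
  case (Suc k)
  have D: "((\<lambda>x. f x + g x) has_derivative
      (\<lambda>b. frechet_derivative f (at x) b + frechet_derivative g (at x) b)) (at x)" if "x \<in> U" for x
    using Suc.prems that by (intro has_derivative_add differentiable_on_openD[OF assms(1)]) auto
  show ?case
    by (rule Ck_on_SucI[OF assms(1) D]) (use Suc in auto)
qed

lemma Ck_on_sum:
  assumes "open U" "finite A" "\<And>a. a \<in> A \<Longrightarrow> Ck_on k U (f a)"
  shows "Ck_on k U (\<lambda>x. \<Sum>a\<in>A. f a x)"
  using assms(2,3) by (induction A rule: finite_induct) (auto intro: Ck_on_const Ck_on_add[OF assms(1)])

lemma Ck_on_mult:
  fixes f g :: "'a::euclidean_space \<Rightarrow> real"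
  assumes "open U" "Ck_on k U f" "Ck_on k U g"
  shows "Ck_on k U (\<lambda>x. f x * g x)"
  using assms(2,3)
proof (induction k arbitrary: f g)
  case 0
  then show ?case by (simp add: continuous_on_mult)
next
  case (Suc k)
  have D: "((\<lambda>x. f x * g x) has_derivative
      (\<lambda>b. f x * frechet_derivative g (at x) b + frechet_derivative f (at x) b * g x)) (at x)" if "x \<in> U" for x
    using Suc.prems that by (intro has_derivative_mult differentiable_on_openD[OF assms(1)]) auto
  show ?case
    by (rule Ck_on_SucI[OF assms(1) D])
       (use Suc Ck_on_SucD[of k U f] Ck_on_SucD[of k U g] in \<open>auto intro!: Ck_on_add[OF assms(1)]\<close>)
qed

lemma Ck_on_inverse:
  fixes f :: "'a::euclidean_space \<Rightarrow> real"
  assumes "open U" "Ck_on k U f" "\<And>x. x \<in> U \<Longrightarrow> f x \<noteq> 0"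
  shows "Ck_on k U (\<lambda>x. inverse (f x))"
  using assms(2)
proof (induction k)
  case 0
  then show ?case using assms(3) by (simp add: continuous_on_inverse)
next
  case (Suc k)
  have D: "((\<lambda>x. inverse (f x)) has_derivative
      (\<lambda>b. (- 1) * (inverse (f x) * frechet_derivative f (at x) b * inverse (f x)))) (at x)" if "x \<in> U" for x
  proof -
    have "(f has_derivative frechet_derivative f (at x)) (at x)"
      using Suc.prems that by (intro differentiable_on_openD[OF assms(1)]) auto
    from Deriv.has_derivative_inverse[OF assms(3)[OF that] this] show ?thesis by simp
  qed
  have i: "Ck_on k U (\<lambda>x. inverse (f x))" using Suc Ck_on_SucD by blast
  show ?case
  proof (rule Ck_on_SucI[OF assms(1) D])
    fix b :: 'a assume "b \<in> Basis"
    then have "Ck_on k U (\<lambda>x. frechet_derivative f (at x) b)" using Suc.prems by simp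
    then show "Ck_on k U (\<lambda>x. (- 1) * (inverse (f x) * frechet_derivative f (at x) b * inverse (f x)))"
      by (intro Ck_on_mult[OF assms(1)] Ck_on_const i)
  qed
qed

text \<open>For a linear inner map the chain rule expresses each partial derivative as a constant linear combination of partial
  derivatives of \<open>f\<close>, composed with the same map. The induction therefore closes, and it applies to \<open>left\<close>, \<open>right\<close>
  and to linear forms.\<close>

lemma Ck_on_linear_substitution:
  fixes L :: "'a::euclidean_space \<Rightarrow> 'c::euclidean_space"
  assumes L: "bounded_linear L" and U: "open U" and f: "Ck_on k U f"
  shows "Ck_on k (L -` U) (\<lambda>x. f (L x))"
  using f
proof (induction k arbitrary: f)
  case 0
  then show ?case
    using continuous_on_compose2[of U f "L -` U" L] linear_continuous_on[OF L] by auto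
next
  case (Suc k)
  have op: "open (L -` U)"
    using open_vimage[OF U] linear_continuous_on[OF L] by blast
  have D: "((\<lambda>x. f (L x)) has_derivative
      (\<lambda>b. \<Sum>e\<in>Basis. (L b \<bullet> e) *\<^sub>R frechet_derivative f (at (L x)) e)) (at x)" if "x \<in> L -` U" for x
  proof -
    have "(f has_derivative frechet_derivative f (at (L x))) (at (L x))"
      using Suc.prems that by (intro differentiable_on_openD[OF U]) auto
    then have "((\<lambda>x. f (L x)) has_derivative (\<lambda>b. frechet_derivative f (at (L x)) (L b))) (at x)"
      and lin: "linear (frechet_derivative f (at (L x)))"
      using has_derivative_compose[OF bounded_linear_imp_has_derivative[OF L]] has_derivative_linear by blast+
    moreover have "frechet_derivative f (at (L x)) (L b)
        = (\<Sum>e\<in>Basis. (L b \<bullet> e) *\<^sub>R frechet_derivative f (at (L x)) e)" for b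
      using linear_sum[OF lin, of "\<lambda>e. (L b \<bullet> e) *\<^sub>R e" Basis] linear_scale[OF lin]
      by (simp add: euclidean_representation)
    ultimately show ?thesis by simp
  qed
  show ?case
    by (rule Ck_on_SucI[OF op D])
       (use Suc in \<open>auto intro!: Ck_on_sum[OF op] Ck_on_compose_bounded_linear[OF bounded_linear_scaleR_right op]\<close>)
qed

lemma smooth_on_cong:
  assumes "open U" "\<And>x. x \<in> U \<Longrightarrow> f x = g x"
  shows "smooth_on U f \<longleftrightarrow> smooth_on U g"
  unfolding smooth_on_def by (simp only: Ck_on_cong[OF assms])

lemma smooth_on_subset: "smooth_on U f \<Longrightarrow> V \<subseteq> U \<Longrightarrow> smooth_on V f"
  unfolding smooth_on_def using Ck_on_subset by blast

lemma smooth_on_const: "smooth_on U (\<lambda>_. c)"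
  unfolding smooth_on_def using Ck_on_const by blast

lemma smooth_on_bounded_linear: "bounded_linear L \<Longrightarrow> open U \<Longrightarrow> smooth_on U L"
  unfolding smooth_on_def using Ck_on_bounded_linear by blast

lemma smooth_on_compose_bounded_linear:
  "bounded_linear L \<Longrightarrow> open U \<Longrightarrow> smooth_on U f \<Longrightarrow> smooth_on U (\<lambda>x. L (f x))"
  unfolding smooth_on_def using Ck_on_compose_bounded_linear by blast

lemma smooth_on_add:
  "open U \<Longrightarrow> smooth_on U f \<Longrightarrow> smooth_on U g \<Longrightarrow> smooth_on U (\<lambda>x. f x + g x)"
  unfolding smooth_on_def using Ck_on_add by blast

lemma smooth_on_mult:
  fixes f g :: "'a::euclidean_space \<Rightarrow> real"
  shows "open U \<Longrightarrow> smooth_on U f \<Longrightarrow> smooth_on U g \<Longrightarrow> smooth_on U (\<lambda>x. f x * g x)"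
  unfolding smooth_on_def using Ck_on_mult by blast

lemma smooth_on_inverse:
  fixes f :: "'a::euclidean_space \<Rightarrow> real"
  shows "open U \<Longrightarrow> smooth_on U f \<Longrightarrow> (\<And>x. x \<in> U \<Longrightarrow> f x \<noteq> 0) \<Longrightarrow> smooth_on U (\<lambda>x. inverse (f x))"
  unfolding smooth_on_def using Ck_on_inverse by blast

lemma smooth_on_linear_substitution:
  fixes L :: "'a::euclidean_space \<Rightarrow> 'c::euclidean_space"
  shows "bounded_linear L \<Longrightarrow> open U \<Longrightarrow> smooth_on U f \<Longrightarrow> smooth_on (L -` U) (\<lambda>x. f (L x))"
  unfolding smooth_on_def using Ck_on_linear_substitution by blast

lemma smooth_on_has_derivative:
  "open U \<Longrightarrow> smooth_on U f \<Longrightarrow> x \<in> U \<Longrightarrow> (f has_derivative frechet_derivative f (at x)) (at x)"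
  unfolding smooth_on_def using differentiable_on_openD Ck_on.simps(2) by metis

lemma smooth_on_differentiable: "open U \<Longrightarrow> smooth_on U f \<Longrightarrow> x \<in> U \<Longrightarrow> f differentiable at x"
  using smooth_on_has_derivative differentiableI by blast

lemma smooth_on_frechet_derivative:
  "smooth_on U f \<Longrightarrow> b \<in> Basis \<Longrightarrow> smooth_on U (\<lambda>x. frechet_derivative f (at x) b)"
  unfolding smooth_on_def using Ck_on.simps(2) by blast

lemma smooth_on_partial: "smooth_on U f \<Longrightarrow> smooth_on U (partial k f)"
  unfolding partial_def[abs_def] by (rule smooth_on_frechet_derivative) (simp_all add: axis_in_Basis_iff)

lemma smooth_on_has_real_derivative:
  fixes u :: "real \<Rightarrow> real"
  assumes "open I" "smooth_on I u" "t \<in> I"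
  shows "(u has_real_derivative deriv u t) (at t)"
proof -
  have "u differentiable (at t)" using smooth_on_differentiable[OF assms] .
  then show ?thesis
    by (meson DERIV_deriv_iff_real_differentiable)
qed

lemma smooth_on_deriv:
  fixes u :: "real \<Rightarrow> real"
  assumes "open I" "smooth_on I u"
  shows "smooth_on I (deriv u)"
proof -
  have "frechet_derivative u (at t) 1 = deriv u t" if "t \<in> I" for t
  proof -
    have "(u has_derivative (\<lambda>x. deriv u t * x)) (at t)"
      using smooth_on_has_real_derivative[OF assms that] by (simp add: has_field_derivative_def)
    then show ?thesis using frechet_derivative_at by (metis mult.right_neutral)
  qed
  then have "smooth_on I (\<lambda>t. frechet_derivative u (at t) 1) \<longleftrightarrow> smooth_on I (deriv u)"
    by (rule smooth_on_cong[OF assms(1)])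
  then show ?thesis using smooth_on_frechet_derivative[OF assms(2), of 1] by simp
qed

lemma open_left_right:
  assumes "open A" "open B" shows "open {z. left z \<in> A \<and> right z \<in> B}"
proof -
  have "open (left -` A)" "open (right -` B)"
    using open_vimage[OF assms(1)] open_vimage[OF assms(2)] linear_continuous_on[OF bounded_linear_left]
      linear_continuous_on[OF bounded_linear_right] by blast+
  then have "open (left -` A \<inter> right -` B)" by (rule open_Int)
  moreover have "left -` A \<inter> right -` B = {z. left z \<in> A \<and> right z \<in> B}" by auto
  ultimately show ?thesis by simp
qed

lemma smooth_on_left:
  assumes "open A" "open B" "smooth_on A u"
  shows "smooth_on {z. left z \<in> A \<and> right z \<in> B} (\<lambda>z. u (left z))"
  by (rule smooth_on_subset[OF smooth_on_linear_substitution[OF bounded_linear_left assms(1,3)]]) auto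

lemma smooth_on_right:
  assumes "open A" "open B" "smooth_on B u"
  shows "smooth_on {z. left z \<in> A \<and> right z \<in> B} (\<lambda>z. u (right z))"
  by (rule smooth_on_subset[OF smooth_on_linear_substitution[OF bounded_linear_right assms(2,3)]]) auto

lemma join_split: "join x y = join x 0 + join 0 y"
  by (simp add: plus_vec_eq_iff join_def)

lemma bounded_linear_join_left: "bounded_linear (\<lambda>x. join x 0)"
  and bounded_linear_join_right: "bounded_linear (\<lambda>y. join 0 y)"
  unfolding linear_conv_bounded_linear[symmetric]
  by (auto intro!: linearI simp: plus_vec_eq_iff join_def)

text \<open>A map into the product is the sum of its two components pushed forward by linear inclusions, so its smoothness
  follows from the linear cases alone.\<close>

lemma smooth_on_join:
  assumes "open A" "open B" "smooth_on A u" "smooth_on B v"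
  shows "smooth_on {z. left z \<in> A \<and> right z \<in> B} (\<lambda>z. join (u (left z)) (v (right z)))"
  by (subst join_split)
     (intro smooth_on_add open_left_right assms
       smooth_on_compose_bounded_linear[OF bounded_linear_join_left]
       smooth_on_compose_bounded_linear[OF bounded_linear_join_right] smooth_on_left smooth_on_right)

section \<open>Product manifolds\<close>

lemma second_countable_prod_topology:
  assumes "second_countable X" "second_countable Y"
  shows "second_countable (prod_topology X Y)"
proof -
  obtain B where B: "countable B" "\<And>V. V \<in> B \<Longrightarrow> openin X V"
    "\<And>U x. openin X U \<Longrightarrow> x \<in> U \<Longrightarrow> \<exists>V\<in>B. x \<in> V \<and> V \<subseteq> U"
    using assms(1) unfolding second_countable_def by metis
  obtain C where C: "countable C" "\<And>V. V \<in> C \<Longrightarrow> openin Y V"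
    "\<And>U x. openin Y U \<Longrightarrow> x \<in> U \<Longrightarrow> \<exists>V\<in>C. x \<in> V \<and> V \<subseteq> U"
    using assms(2) unfolding second_countable_def by metis
  let ?D = "(\<lambda>(V, V'). V \<times> V') ` (B \<times> C)"
  show ?thesis
    unfolding second_countable_def
  proof (intro exI[of _ ?D] conjI ballI allI impI)
    show "countable ?D" using B(1) C(1) by simp
    show "openin (prod_topology X Y) V" if "V \<in> ?D" for V
      using that B(2) C(2) by (auto simp: openin_prod_Times_iff)
    fix U x assume Ux: "openin (prod_topology X Y) U \<and> x \<in> U"
    obtain p q where x: "x = (p, q)" by (cases x)
    obtain U1 U2 where U: "openin X U1" "openin Y U2" "p \<in> U1" "q \<in> U2" "U1 \<times> U2 \<subseteq> U"
      using Ux unfolding x openin_prod_topology_alt by metis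
    obtain V1 V2 where V: "V1 \<in> B" "p \<in> V1" "V1 \<subseteq> U1" "V2 \<in> C" "q \<in> V2" "V2 \<subseteq> U2"
      using B(3)[OF U(1,3)] C(3)[OF U(2,4)] by auto
    then have "V1 \<times> V2 \<in> ?D" "x \<in> V1 \<times> V2" "V1 \<times> V2 \<subseteq> U" using U(5) x by auto
    then show "\<exists>V\<in>?D. x \<in> V \<and> V \<subseteq> U" by blast
  qed
qed

lemma second_countable_top_of_set:
  fixes S :: "'a::second_countable_topology set"
  shows "second_countable (top_of_set S)"
proof -
  obtain B :: "'a set set" where "countable B" "topological_basis B"
    using ex_countable_basis by blast
  then have "second_countable (euclidean :: 'a topology)"
    unfolding second_countable_def topological_basis_def
    by (metis Union_iff open_openin subsetD Union_upper topological_basisE \<open>topological_basis B\<close>)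
  then show ?thesis by (rule second_countable_subtopology)
qed

lemma chart_of:
  assumes "smooth_manifold M" "i \<in> Idx M"
  shows chart_homeo: "homeomorphic_map (subtopology (Top M) (Dom M i)) (top_of_set (Img M i)) (Coord M i)"
    and open_Dom: "openin (Top M) (Dom M i)"
    and open_Img: "open (Img M i)"
    and inj_chart: "inj_on (Coord M i) (Dom M i)"
proof -
  show *: "homeomorphic_map (subtopology (Top M) (Dom M i)) (top_of_set (Img M i)) (Coord M i)"
    "openin (Top M) (Dom M i)" "open (Img M i)"
    using assms unfolding smooth_manifold_def by blast+
  then have "topspace (subtopology (Top M) (Dom M i)) = Dom M i"
    using openin_subset[OF *(2)] by (simp add: topspace_subtopology Int_absorb1)
  then show "inj_on (Coord M i) (Dom M i)"
    using homeomorphic_imp_injective_map[OF *(1)] by simp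
qed

lemma Param_Coord: "smooth_manifold M \<Longrightarrow> i \<in> Idx M \<Longrightarrow> p \<in> Dom M i \<Longrightarrow> Param M i (Coord M i p) = p"
  unfolding Param_def by (simp add: inj_chart)

lemma Param_in_Dom: "y \<in> Img M i \<Longrightarrow> Param M i y \<in> Dom M i"
  and Coord_Param: "y \<in> Img M i \<Longrightarrow> Coord M i (Param M i y) = y"
  unfolding Param_def Img_def by (auto intro: inv_into_into f_inv_into_f)

lemma open_chart_overlap:
  assumes "smooth_manifold M" "i \<in> Idx M" "j \<in> Idx M"
  shows "open (Coord M i ` (Dom M i \<inter> Dom M j))"
proof -
  have "openin (subtopology (Top M) (Dom M i)) (Dom M i \<inter> Dom M j)"
    using open_Dom[OF assms(1)] assms by (simp add: openin_subtopology_Int2)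
  then have "openin (top_of_set (Img M i)) (Coord M i ` (Dom M i \<inter> Dom M j))"
    using homeomorphic_imp_open_map[OF chart_homeo[OF assms(1,2)]] by (simp add: open_map_def)
  then show ?thesis using open_Img[OF assms(1,2)] openin_open_trans by blast
qed

text \<open>Chart expressions of a globally defined function agree under change of charts. The warping function has to match in
  this way for the warped metric to be a tensor.\<close>

lemma in_chart_transition:
  assumes "smooth_manifold M" "i \<in> Idx M" "j \<in> Idx M" "y \<in> Coord M i ` (Dom M i \<inter> Dom M j)"
  shows "in_chart M j u (transition M i j y) = in_chart M i u y"
  using assms by (auto simp: in_chart_def transition_def Param_Coord)

lemma prod_manifold_simps [simp]:
  "Top (prod_manifold B F) = prod_topology (Top B) (Top F)"
  "Idx (prod_manifold B F) = Idx B \<times> Idx F"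
  "Dom (prod_manifold B F) (i, j) = Dom B i \<times> Dom F j"
  "Coord (prod_manifold B F) (i, j) (p, q) = join (Coord B i p) (Coord F j q)"
  by (simp_all add: prod_manifold_def)

lemma image_Coord_prod:
  "Coord (prod_manifold B F) (i, j) ` (S \<times> T) = {z. left z \<in> Coord B i ` S \<and> right z \<in> Coord F j ` T}"
proof (intro set_eqI iffI)
  fix z assume "z \<in> {z. left z \<in> Coord B i ` S \<and> right z \<in> Coord F j ` T}"
  then obtain p q where "p \<in> S" "q \<in> T" "left z = Coord B i p" "right z = Coord F j q" by auto
  then have "z = Coord (prod_manifold B F) (i, j) (p, q)" by (metis join_left_right prod_manifold_simps(4))
  then show "z \<in> Coord (prod_manifold B F) (i, j) ` (S \<times> T)" using \<open>p \<in> S\<close> \<open>q \<in> T\<close> by blast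
qed auto

lemma Img_prod: "Img (prod_manifold B F) (i, j) = {z. left z \<in> Img B i \<and> right z \<in> Img F j}"
  unfolding Img_def by (simp add: image_Coord_prod)

text \<open>Only for points of the image: elsewhere the inverse chart is an unspecified value.\<close>

lemma Param_prod:
  assumes "smooth_manifold B" "smooth_manifold F" "i \<in> Idx B" "j \<in> Idx F"
    and "z \<in> Img (prod_manifold B F) (i, j)"
  shows "Param (prod_manifold B F) (i, j) z = (Param B i (left z), Param F j (right z))"
proof -
  have z: "left z \<in> Img B i" "right z \<in> Img F j" using assms(5) by (auto simp: Img_prod)
  have "inj_on (Coord (prod_manifold B F) (i, j)) (Dom B i \<times> Dom F j)"
  proof (rule inj_onI)
    fix x y assume xy: "x \<in> Dom B i \<times> Dom F j" "y \<in> Dom B i \<times> Dom F j"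
      "Coord (prod_manifold B F) (i, j) x = Coord (prod_manifold B F) (i, j) y"
    then obtain p q p' q' where "x = (p, q)" "y = (p', q')" by (metis surj_pair)
    moreover from this xy(3) have "Coord B i p = Coord B i p'" "Coord F j q = Coord F j q'"
      by (metis left_join right_join prod_manifold_simps(4))+
    ultimately show "x = y"
      using xy inj_chart[OF assms(1,3)] inj_chart[OF assms(2,4)] by (auto dest: inj_onD)
  qed
  moreover have "Coord (prod_manifold B F) (i, j) (Param B i (left z), Param F j (right z)) = z"
    using z by (simp add: Coord_Param)
  ultimately show ?thesis
    unfolding Param_def[of "prod_manifold B F"]
    by (intro inv_into_f_eq) (use z in \<open>auto simp: Param_in_Dom\<close>)
qed

lemma transition_prod:
  assumes "smooth_manifold B" "smooth_manifold F" "i \<in> Idx B" "j \<in> Idx F"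
    and "z \<in> Img (prod_manifold B F) (i, j)"
  shows "transition (prod_manifold B F) (i, j) (i', j') z
    = join (transition B i i' (left z)) (transition F j j' (right z))"
  by (simp add: transition_def Param_prod[OF assms])

lemma homeomorphic_map_join:
  "homeomorphic_map (top_of_set (A \<times> B)) (top_of_set {z. left z \<in> A \<and> right z \<in> B}) (\<lambda>(x, y). join x y)"
proof -
  have "homeomorphic_maps (top_of_set (A \<times> B)) (top_of_set {z. left z \<in> A \<and> right z \<in> B})
      (\<lambda>p. join (fst p) (snd p)) (\<lambda>z. (left z, right z))"
    unfolding homeomorphic_maps_def
    by (auto intro!: linear_continuous_on bounded_linear_Pair bounded_linear_join bounded_linear_left bounded_linear_right)
  then show ?thesis
    by (auto simp: homeomorphic_map_maps case_prod_unfold)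
qed

lemma homeomorphic_map_Coord_prod:
  assumes "smooth_manifold B" "smooth_manifold F" "i \<in> Idx B" "j \<in> Idx F"
  shows "homeomorphic_map (subtopology (prod_topology (Top B) (Top F)) (Dom B i \<times> Dom F j))
      (top_of_set (Img (prod_manifold B F) (i, j))) (Coord (prod_manifold B F) (i, j))"
proof -
  obtain k where k: "homeomorphic_maps (subtopology (Top B) (Dom B i)) (top_of_set (Img B i)) (Coord B i) k"
    using chart_homeo[OF assms(1,3)] by (auto simp: homeomorphic_map_maps)
  obtain l where l: "homeomorphic_maps (subtopology (Top F) (Dom F j)) (top_of_set (Img F j)) (Coord F j) l"
    using chart_homeo[OF assms(2,4)] by (auto simp: homeomorphic_map_maps)
  have "homeomorphic_map (subtopology (prod_topology (Top B) (Top F)) (Dom B i \<times> Dom F j))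
      (top_of_set (Img B i \<times> Img F j)) (\<lambda>(p, q). (Coord B i p, Coord F j q))"
    unfolding homeomorphic_map_maps subtopology_Times prod_topology_subtopology_eu[symmetric]
    using k l homeomorphic_maps_prod by blast
  from homeomorphic_map_compose[OF this homeomorphic_map_join]
  have "homeomorphic_map (subtopology (prod_topology (Top B) (Top F)) (Dom B i \<times> Dom F j))
      (top_of_set (Img (prod_manifold B F) (i, j)))
      ((\<lambda>(x, y). join x y) \<circ> (\<lambda>(p, q). (Coord B i p, Coord F j q)))"
    by (simp add: Img_prod)
  moreover have "(\<lambda>(x, y). join x y) \<circ> (\<lambda>(p, q). (Coord B i p, Coord F j q)) = Coord (prod_manifold B F) (i, j)"
    by (auto simp: fun_eq_iff)
  ultimately show ?thesis by simp
qed

text \<open>Charts, transition maps and their domains all factor through \<open>join\<close>; the topological properties are those of binary products.\<close>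

lemma smooth_manifold_prod:
  assumes B: "smooth_manifold B" and F: "smooth_manifold F"
  shows "smooth_manifold (prod_manifold B F)"
  unfolding smooth_manifold_def
proof (intro conjI ballI)
  show "Hausdorff_space (Top (prod_manifold B F))" "second_countable (Top (prod_manifold B F))"
    using assms by (simp_all add: smooth_manifold_def Hausdorff_space_prod_topology second_countable_prod_topology)
  have "topspace (Top B) = (\<Union>i\<in>Idx B. Dom B i)" "topspace (Top F) = (\<Union>i\<in>Idx F. Dom F i)"
    using assms by (simp_all add: smooth_manifold_def)
  then show "topspace (Top (prod_manifold B F)) = (\<Union>k\<in>Idx (prod_manifold B F). Dom (prod_manifold B F) k)"
    by (fastforce simp: prod_manifold_def)
next
  fix k assume "k \<in> Idx (prod_manifold B F)"
  then obtain i j where k: "k = (i, j)" and ij: "i \<in> Idx B" "j \<in> Idx F" by auto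
  show "openin (Top (prod_manifold B F)) (Dom (prod_manifold B F) k)"
    using open_Dom[OF B ij(1)] open_Dom[OF F ij(2)] by (simp add: k openin_prod_Times_iff)
  show "open (Img (prod_manifold B F) k)"
    unfolding k Img_prod by (rule open_left_right[OF open_Img[OF B ij(1)] open_Img[OF F ij(2)]])
  show "homeomorphic_map (subtopology (Top (prod_manifold B F)) (Dom (prod_manifold B F) k))
      (top_of_set (Img (prod_manifold B F) k)) (Coord (prod_manifold B F) k)"
    using homeomorphic_map_Coord_prod[OF assms ij] by (simp add: k)
  fix k' assume "k' \<in> Idx (prod_manifold B F)"
  then obtain i' j' where k': "k' = (i', j')" and ij': "i' \<in> Idx B" "j' \<in> Idx F" by auto
  let ?O = "Coord (prod_manifold B F) k ` (Dom (prod_manifold B F) k \<inter> Dom (prod_manifold B F) k')"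
  let ?OB = "Coord B i ` (Dom B i \<inter> Dom B i')" and ?OF = "Coord F j ` (Dom F j \<inter> Dom F j')"
  have O: "?O = {z. left z \<in> ?OB \<and> right z \<in> ?OF}"
    unfolding k k' by (simp add: Times_Int_Times image_Coord_prod)
  have op: "open ?OB" "open ?OF"
    using open_chart_overlap[OF B ij(1) ij'(1)] open_chart_overlap[OF F ij(2) ij'(2)] .
  have "smooth_on ?OB (transition B i i')" "smooth_on ?OF (transition F j j')"
    using B F ij ij' unfolding smooth_manifold_def by blast+
  from smooth_on_join[OF op this]
  have "smooth_on ?O (\<lambda>z. join (transition B i i' (left z)) (transition F j j' (right z)))"
    unfolding O .
  moreover have "transition (prod_manifold B F) k k' z = join (transition B i i' (left z)) (transition F j j' (right z))"
    if "z \<in> ?O" for z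
  proof -
    have "z \<in> Img (prod_manifold B F) (i, j)" using that unfolding k Img_def by auto
    then show ?thesis unfolding k k' by (rule transition_prod[OF B F ij])
  qed
  moreover have "open ?O" unfolding O by (rule open_left_right[OF op])
  ultimately show "smooth_on ?O (transition (prod_manifold B F) k k')"
    using smooth_on_cong[of ?O] by (metis (no_types, lifting))
qed

lemma open_submanifold_simps [simp]:
  "Top (open_submanifold U) = top_of_set U" "Idx (open_submanifold U) = {()}"
  "Dom (open_submanifold U) i = U" "Coord (open_submanifold U) i = (\<lambda>x. x)"
  "Img (open_submanifold U) i = U"
  by (simp_all add: open_submanifold_def Img_def)

lemma Param_open_submanifold [simp]: "x \<in> U \<Longrightarrow> Param (open_submanifold U) i x = x"
  using inv_into_f_f[of "\<lambda>x. x" U x] by (simp add: Param_def inj_on_def)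

lemma in_chart_open_submanifold [simp]: "x \<in> U \<Longrightarrow> in_chart (open_submanifold U) i u x = u x"
  by (simp add: in_chart_def)

lemma smooth_manifold_open_submanifold:
  assumes "open U" shows "smooth_manifold (open_submanifold U)"
proof -
  have "smooth_on U (transition (open_submanifold U) () ()) \<longleftrightarrow> smooth_on U (\<lambda>x. x)"
    by (rule smooth_on_cong[OF assms]) (simp add: transition_def)
  then have "smooth_on U (transition (open_submanifold U) () ())"
    using smooth_on_bounded_linear[OF bounded_linear_ident assms] by simp
  moreover have "homeomorphic_map (subtopology (top_of_set U) U) (top_of_set U) (\<lambda>x. x)"
    using homeomorphic_map_id[of "top_of_set U" "top_of_set U"] by (simp add: id_def subtopology_subtopology)
  ultimately show ?thesis
    using assms by (simp add: smooth_manifold_def Hausdorff_space_subtopology Hausdorff_space_euclidean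
        second_countable_top_of_set)
qed

lemma smooth_function_open_submanifold:
  assumes "open U" "smooth_on U u" shows "smooth_function (open_submanifold U) u"
  unfolding smooth_function_def
  using assms smooth_on_cong[OF assms(1), of "in_chart (open_submanifold U) () u" u] by simp

lemma in_chart_prod_fst:
  assumes "smooth_manifold B" "smooth_manifold F" "i \<in> Idx B" "j \<in> Idx F"
    and "z \<in> Img (prod_manifold B F) (i, j)"
  shows "in_chart (prod_manifold B F) (i, j) (\<lambda>(p, q). u p) z = in_chart B i u (left z)"
  by (simp add: in_chart_def Param_prod[OF assms])

lemma smooth_function_prod_fst:
  assumes B: "smooth_manifold B" and F: "smooth_manifold F" and u: "smooth_function B u"
  shows "smooth_function (prod_manifold B F) (\<lambda>(p, q). u p)"
  unfolding smooth_function_def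
proof
  fix k assume "k \<in> Idx (prod_manifold B F)"
  then obtain i j where k: "k = (i, j)" and ij: "i \<in> Idx B" "j \<in> Idx F" by auto
  have op: "open (Img B i)" "open (Img F j)" using open_Img[OF B ij(1)] open_Img[OF F ij(2)] .
  have "smooth_on (Img (prod_manifold B F) k) (in_chart (prod_manifold B F) k (\<lambda>(p, q). u p))
      \<longleftrightarrow> smooth_on (Img (prod_manifold B F) k) (\<lambda>z. in_chart B i u (left z))"
    unfolding k by (rule smooth_on_cong) (simp_all add: Img_prod open_left_right[OF op] in_chart_prod_fst[OF B F ij])
  moreover have "smooth_on (Img (prod_manifold B F) k) (\<lambda>z. in_chart B i u (left z))"
    unfolding k Img_prod using u ij by (intro smooth_on_left[OF op]) (simp add: smooth_function_def)
  ultimately show "smooth_on (Img (prod_manifold B F) k) (in_chart (prod_manifold B F) k (\<lambda>(p, q). u p))"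
    by simp
qed

section \<open>Warped products are semi-Riemannian\<close>

lemma warped_metric_eq_block_diag:
  "warped_metric B gB w gF (i, j) z
    = block_diag (gB i (left z)) ((in_chart B i w (left z))\<^sup>2 *\<^sub>R gF j (right z))"
  by (simp add: plus_vec_eq_iff vec_eq_iff warped_metric_def)

lemma matrix_join_blocks:
  assumes "linear S" "linear T"
  shows "matrix (\<lambda>v. join (S (left v)) (T (right v))) = block_diag (matrix S) (matrix T)"
  using linear_0[OF assms(1)] linear_0[OF assms(2)]
  by (simp add: plus_vec_eq_iff matrix_def join_def)

lemma has_derivative_join_blocks:
  assumes "(u has_derivative u') (at (left z))" "(v has_derivative v') (at (right z))"
  shows "((\<lambda>z. join (u (left z)) (v (right z))) has_derivative (\<lambda>h. join (u' (left h)) (v' (right h)))) (at z)"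
proof -
  have "((\<lambda>z. (u (left z), v (right z))) has_derivative (\<lambda>h. (u' (left h), v' (right h)))) (at z)"
    using has_derivative_compose[OF bounded_linear_imp_has_derivative[OF bounded_linear_left] assms(1)]
      has_derivative_compose[OF bounded_linear_imp_has_derivative[OF bounded_linear_right] assms(2)]
    by (rule has_derivative_Pair)
  from bounded_linear.has_derivative[OF bounded_linear_join this] show ?thesis by simp
qed

lemma transpose_scaleR: "transpose (c *\<^sub>R A) = c *\<^sub>R transpose (A :: real^'k^'l)"
  by (simp add: transpose_def vec_eq_iff)

lemma scaleR_matrix_mult_left: "(c *\<^sub>R A) ** B = c *\<^sub>R (A ** B :: real^'m^'l)" for A :: "real^'k::finite^'l"
  using scaleR_matrix_mult[of c A 1 B] by simp

lemma scaleR_matrix_mult_right: "A ** (c *\<^sub>R B) = c *\<^sub>R (A ** B :: real^'m^'l)" for A :: "real^'k::finite^'l"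
  using scaleR_matrix_mult[of 1 A c B] by simp

lemma has_index_iff:
  fixes A :: "real^'k::finite^'k"
  shows "has_index A k \<longleftrightarrow> (\<exists>(P :: real^'k^'k) s. invertible P \<and> (\<forall>i. s i = 1 \<or> s i = - 1) \<and>
    card {i. s i = - 1} = k \<and> transpose P ** A ** P = diag_matrix s)"
  unfolding has_index_def diag_matrix_def ..

text \<open>An orthonormal basis of the first block together with one of the second block, rescaled by \<open>1 / c\<close>, is orthonormal
  for the block matrix. Its timelike vectors are those of both blocks.\<close>

lemma has_index_block_diag:
  fixes A :: "real^'n::finite^'n" and B :: "real^'d::finite^'d"
  assumes A: "has_index A k" and B: "has_index B m" and "c \<noteq> 0"
  shows "has_index (block_diag A (c\<^sup>2 *\<^sub>R B)) (k + m)"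
proof -
  obtain P :: "real^'n^'n" and s where P: "invertible P" "\<forall>i. s i = 1 \<or> s i = - 1" "card {i. s i = - 1} = k"
    "transpose P ** A ** P = diag_matrix s"
    using A unfolding has_index_iff by blast
  obtain Q :: "real^'d^'d" and r where Q: "invertible Q" "\<forall>i. r i = 1 \<or> r i = - 1" "card {i. r i = - 1} = m"
    "transpose Q ** B ** Q = diag_matrix r"
    using B unfolding has_index_iff by blast
  let ?R = "block_diag P (inverse c *\<^sub>R Q)" and ?t = "case_sum s r"
  have "(inverse c *\<^sub>R Q) ** (c *\<^sub>R matrix_inv Q) = mat 1"
    using \<open>c \<noteq> 0\<close> by (simp add: scaleR_matrix_mult invertible_matrix_inv[OF Q(1)])
  then have inv: "invertible ?R"
    using matrix_inv_block_diag(2)[OF invertible_matrix_inv(1)[OF P(1)]] by blast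
  have eq: "transpose ?R ** block_diag A (c\<^sup>2 *\<^sub>R B) ** ?R = diag_matrix ?t"
  proof -
    have "transpose (inverse c *\<^sub>R Q) ** (c\<^sup>2 *\<^sub>R B) ** (inverse c *\<^sub>R Q) = diag_matrix r"
    proof -
      have "inverse c * c\<^sup>2 * inverse c = 1" using \<open>c \<noteq> 0\<close> by (simp add: field_simps power2_eq_square)
      then show ?thesis by (simp only: transpose_scaleR scaleR_matrix_mult Q(4) scaleR_one)
    qed
    then have "transpose ?R ** block_diag A (c\<^sup>2 *\<^sub>R B) ** ?R = block_diag (diag_matrix s) (diag_matrix r)"
      by (simp only: block_diag_transpose block_diag_mult P(4))
    also have "\<dots> = diag_matrix ?t" by (simp add: plus_vec_eq_iff)
    finally show ?thesis .
  qed
  have "{x. ?t x = - 1} = Inl ` {i. s i = - 1} \<union> Inr ` {i. r i = - 1}"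
  proof (intro set_eqI)
    fix x show "x \<in> {x. ?t x = - 1} \<longleftrightarrow> x \<in> Inl ` {i. s i = - 1} \<union> Inr ` {i. r i = - 1}"
      by (cases x) auto
  qed
  then have "card {x. ?t x = - 1} = card (Inl ` {i. s i = - 1} :: ('n + 'd) set) + card (Inr ` {i. r i = - 1} :: ('n + 'd) set)"
    by (simp only:) (rule card_Un_disjoint; auto)
  then have card: "card {x. ?t x = - 1} = k + m"
    by (simp add: card_image P(3) Q(3))
  have "?t x = 1 \<or> ?t x = - 1" for x using P(2) Q(2) by (cases x) auto
  then show ?thesis
    unfolding has_index_iff
    by (intro exI[of _ ?R] exI[of _ ?t] conjI allI inv eq card)
qed

text \<open>In a product chart the metric is block diagonal with the Jacobian of a change of charts block diagonal as well, so
  each requirement reduces to the two factors.\<close>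

lemma semi_riemannian_warped_metric:
  assumes "semi_riemannian_manifold B gB" "semi_riemannian_manifold F gF"
    and w: "smooth_function B w" and w_nz: "\<And>p. p \<in> topspace (Top B) \<Longrightarrow> w p \<noteq> 0"
  shows "semi_riemannian_manifold (prod_manifold B F) (warped_metric B gB w gF)"
proof -
  have B: "smooth_manifold B" and F: "smooth_manifold F"
    and gB: "semi_riemannian_metric B gB" and gF: "semi_riemannian_metric F gF"
    using assms by (auto simp: semi_riemannian_manifold_def)
  have nz: "in_chart B i w y \<noteq> 0" if "i \<in> Idx B" "y \<in> Img B i" for i y
  proof -
    have "Param B i y \<in> topspace (Top B)"
      using Param_in_Dom[OF that(2)] openin_subset[OF open_Dom[OF B that(1)]] by blast
    then show ?thesis using w_nz by (simp add: in_chart_def)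
  qed
  let ?M = "prod_manifold B F" and ?g = "warped_metric B gB w gF"
  have smooth: "smooth_on (Img ?M k) (\<lambda>y. ?g k y $ a $ b)" if k_in: "k \<in> Idx ?M" for k a b
  proof -
    obtain i j where k: "k = (i, j)" and ij: "i \<in> Idx B" "j \<in> Idx F" using k_in by auto
    have op: "open (Img B i)" "open (Img F j)" using open_Img[OF B ij(1)] open_Img[OF F ij(2)] .
    have sB: "smooth_on (Img B i) (\<lambda>y. gB i y $ p $ q)" for p q
      using gB ij unfolding semi_riemannian_metric_def by blast
    have sF: "smooth_on (Img F j) (\<lambda>y. gF j y $ p $ q)" for p q
      using gF ij unfolding semi_riemannian_metric_def by blast
    have sw: "smooth_on (Img B i) (in_chart B i w)" using w ij by (simp add: smooth_function_def)
    show ?thesis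
      unfolding k Img_prod warped_metric_eq_block_diag
      using smooth_on_left[OF op sB] smooth_on_right[OF op sF] smooth_on_left[OF op sw]
      by (cases a; cases b)
         (auto simp: smooth_on_const power2_eq_square intro!: smooth_on_mult[OF open_left_right[OF op]])
  qed
  have trans: "?g k y = transpose J ** ?g k' (transition ?M k k' y) ** J"
    if k_in: "k \<in> Idx ?M" "k' \<in> Idx ?M" and y: "y \<in> Coord ?M k ` (Dom ?M k \<inter> Dom ?M k')"
      and J: "J = matrix (frechet_derivative (transition ?M k k') (at y))" for k k' y J
  proof -
    obtain i j i' j' where k: "k = (i, j)" "k' = (i', j')"
      and ij: "i \<in> Idx B" "j \<in> Idx F" "i' \<in> Idx B" "j' \<in> Idx F" using k_in by auto
    let ?OB = "Coord B i ` (Dom B i \<inter> Dom B i')" and ?OF = "Coord F j ` (Dom F j \<inter> Dom F j')"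
    let ?O = "{z. left z \<in> ?OB \<and> right z \<in> ?OF}"
    have y': "left y \<in> ?OB" "right y \<in> ?OF" "y \<in> ?O"
      using y unfolding k by (auto simp: Times_Int_Times image_Coord_prod)
    have op: "open ?OB" "open ?OF"
      using open_chart_overlap[OF B ij(1,3)] open_chart_overlap[OF F ij(2,4)] .
    let ?tB = "transition B i i'" and ?tF = "transition F j j'"
    have tr: "transition ?M k k' z = join (?tB (left z)) (?tF (right z))" if "z \<in> ?O" for z
    proof -
      have "z \<in> Img ?M (i, j)" using that unfolding Img_prod by (auto simp: Img_def)
      then show ?thesis unfolding k by (rule transition_prod[OF B F ij(1,2)])
    qed
    have "smooth_on ?OB ?tB" "smooth_on ?OF ?tF"
      using B F ij unfolding smooth_manifold_def by blast+
    note smooth_t = this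
    have DB: "(?tB has_derivative frechet_derivative ?tB (at (left y))) (at (left y))"
      and DF: "(?tF has_derivative frechet_derivative ?tF (at (right y))) (at (right y))"
      using smooth_on_has_derivative[OF op(1) smooth_t(1) y'(1)]
        smooth_on_has_derivative[OF op(2) smooth_t(2) y'(2)] .
    let ?JB = "matrix (frechet_derivative ?tB (at (left y)))"
      and ?JF = "matrix (frechet_derivative ?tF (at (right y)))"
    have cong: "(transition ?M k k' has_derivative D) (at y)
        \<longleftrightarrow> ((\<lambda>z. join (?tB (left z)) (?tF (right z))) has_derivative D) (at y)" for D
      by (rule has_derivative_cong_open[OF open_left_right[OF op] y'(3)]) (rule tr)
    have "(transition ?M k k' has_derivative
       (\<lambda>h. join (frechet_derivative ?tB (at (left y)) (left h)) (frechet_derivative ?tF (at (right y)) (right h)))) (at y)"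
      unfolding cong by (rule has_derivative_join_blocks[OF DB DF])
    then have J': "J = block_diag ?JB ?JF"
      unfolding J using matrix_join_blocks[OF has_derivative_linear[OF DB] has_derivative_linear[OF DF]]
      by (simp only: frechet_derivative_at[symmetric])
    have eB: "gB i (left y) = transpose ?JB ** gB i' (?tB (left y)) ** ?JB"
      using gB ij y' unfolding semi_riemannian_metric_def Let_def by blast
    have eF: "gF j (right y) = transpose ?JF ** gF j' (?tF (right y)) ** ?JF"
      using gF ij y' unfolding semi_riemannian_metric_def Let_def by blast
    have "?g k' (transition ?M k k' y)
       = block_diag (gB i' (?tB (left y))) ((in_chart B i w (left y))\<^sup>2 *\<^sub>R gF j' (?tF (right y)))"
      unfolding tr[OF y'(3)] by (simp add: k warped_metric_eq_block_diag in_chart_transition[OF B ij(1,3) y'(1)])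
    then show ?thesis
      unfolding J' by (simp add: k(1) warped_metric_eq_block_diag block_diag_transpose block_diag_mult
         scaleR_matrix_mult_left scaleR_matrix_mult_right eB[symmetric] eF[symmetric])
  qed
  have point: "transpose (?g k y) = ?g k y \<and> invertible (?g k y)" if k_in: "k \<in> Idx ?M" "y \<in> Img ?M k" for k y
  proof -
    obtain i j where k: "k = (i, j)" and ij: "i \<in> Idx B" "j \<in> Idx F" using k_in by auto
    have y: "left y \<in> Img B i" "right y \<in> Img F j" using k_in(2) unfolding k Img_prod by auto
    have B': "transpose (gB i (left y)) = gB i (left y)" "invertible (gB i (left y))"
      using gB ij y unfolding semi_riemannian_metric_def by blast+
    have F': "transpose (gF j (right y)) = gF j (right y)" "invertible (gF j (right y))"
      using gF ij y unfolding semi_riemannian_metric_def by blast+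
    let ?w = "in_chart B i w (left y)"
    have "(?w\<^sup>2 *\<^sub>R gF j (right y)) ** (inverse (?w\<^sup>2) *\<^sub>R matrix_inv (gF j (right y))) = mat 1"
      using nz[OF ij(1) y(1)] by (simp add: scaleR_matrix_mult invertible_matrix_inv[OF F'(2)])
    from matrix_inv_block_diag(2)[OF invertible_matrix_inv(1)[OF B'(2)] this]
    show ?thesis
      using B' F' by (simp add: k warped_metric_eq_block_diag block_diag_transpose transpose_scaleR)
  qed
  have index: "\<exists>m. \<forall>k\<in>Idx ?M. \<forall>y\<in>Img ?M k. has_index (?g k y) m"
  proof -
    obtain kB where kB: "\<And>i y. i \<in> Idx B \<Longrightarrow> y \<in> Img B i \<Longrightarrow> has_index (gB i y) kB"
      using gB unfolding semi_riemannian_metric_def by blast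
    obtain kF where kF: "\<And>i y. i \<in> Idx F \<Longrightarrow> y \<in> Img F i \<Longrightarrow> has_index (gF i y) kF"
      using gF unfolding semi_riemannian_metric_def by blast
    show ?thesis
      by (rule exI[of _ "kB + kF"])
         (auto simp: Img_prod warped_metric_eq_block_diag nz intro!: has_index_block_diag kB kF)
  qed
  show ?thesis
    unfolding semi_riemannian_manifold_def semi_riemannian_metric_def Let_def
    by (intro conjI ballI allI smooth_manifold_prod[OF B F] smooth trans[OF _ _ _ refl] point index)
qed

text \<open>The rescaled coordinate vectors \<open>\<psi> \<partial>\<^sub>i\<close> are orthonormal, with signs \<open>\<epsilon>\<^sub>i\<close> at every point.\<close>

lemma semi_riemannian_conformal_flat:
  fixes \<epsilon> :: "real^'n::finite"
  assumes "open U" "smooth_on U \<psi>" and \<psi>: "\<And>x. x \<in> U \<Longrightarrow> \<psi> x \<noteq> 0"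
    and \<epsilon>: "\<forall>i. \<epsilon> $ i = 1 \<or> \<epsilon> $ i = -1"
  shows "semi_riemannian_manifold (open_submanifold U) (conformal_flat_metric \<epsilon> \<psi>)"
proof -
  let ?g = "conformal_flat_metric \<epsilon> \<psi> ()"
  have g: "conformal_flat_metric \<epsilon> \<psi> i x = diag_matrix (\<lambda>i. \<epsilon> $ i / (\<psi> x)\<^sup>2)" for i x
    by (simp add: conformal_flat_metric_def diag_matrix_def)
  have sq: "\<epsilon> $ i * \<epsilon> $ i = 1" for i using \<epsilon> by (metis mult_minus1 mult_1 minus_minus)
  have smooth: "smooth_on U (\<lambda>x. ?g x $ a $ b)" for a b
  proof (cases "a = b")
    case True
    have "smooth_on U (\<lambda>x. \<epsilon> $ a * (inverse (\<psi> x) * inverse (\<psi> x)))"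
      using assms by (intro smooth_on_mult smooth_on_const smooth_on_inverse) auto
    then show ?thesis using True by (simp add: g divide_inverse power2_eq_square)
  qed (simp add: g smooth_on_const)
  have trans: "?g x = transpose J ** ?g (transition (open_submanifold U) () () x) ** J"
    if "x \<in> U" and J: "J = matrix (frechet_derivative (transition (open_submanifold U) () ()) (at x))" for x J
  proof -
    have "(transition (open_submanifold U) () () has_derivative (\<lambda>h. h)) (at x)"
      using has_derivative_ident[of "at x"] has_derivative_cong_open[OF assms(1) that(1), of "transition (open_submanifold U) () ()" "\<lambda>x. x"]
      by (simp add: transition_def)
    then have "J = matrix (\<lambda>h. h)"
      unfolding J by (simp only: frechet_derivative_at[symmetric])
    then have "J = mat 1" using matrix_id_mat_1 by (simp add: id_def)
    then show ?thesis using that by (simp add: transition_def transpose_mat)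
  qed
  have inv: "invertible (?g x)" if "x \<in> U" for x
    using matrix_inv_eqI(2)[of "?g x" "diag_matrix (\<lambda>i. \<epsilon> $ i * (\<psi> x)\<^sup>2)"] \<psi>[OF that]
    by (simp add: g diag_matrix_mult sq diag_matrix_1)
  have index: "has_index (?g x) (card {i. \<epsilon> $ i = - 1})" if "x \<in> U" for x
  proof -
    have "transpose (diag_matrix (\<lambda>_. \<psi> x)) ** ?g x ** diag_matrix (\<lambda>_. \<psi> x) = diag_matrix (\<lambda>i. \<epsilon> $ i)"
      using \<psi>[OF that] by (simp add: g diag_matrix_mult power2_eq_square)
    moreover have "invertible (diag_matrix (\<lambda>_::'n. \<psi> x))"
    proof (rule matrix_inv_eqI(2))
      show "diag_matrix (\<lambda>_::'n. \<psi> x) ** diag_matrix (\<lambda>_. inverse (\<psi> x)) = mat 1"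
        unfolding diag_matrix_mult using \<psi>[OF that] by (simp add: diag_matrix_1)
    qed
    ultimately show ?thesis unfolding has_index_def diag_matrix_def using \<epsilon> by blast
  qed
  have "semi_riemannian_metric (open_submanifold U) (conformal_flat_metric \<epsilon> \<psi>)"
    unfolding semi_riemannian_metric_def Let_def
    by (simp, intro conjI ballI allI exI[of _ "card {i. \<epsilon> $ i = - 1}"];
        (rule smooth | (rule trans[OF _ refl], assumption) | (rule inv, assumption)
          | (rule index, assumption) | simp add: g))
  then show ?thesis
    using smooth_manifold_open_submanifold[OF assms(1)] by (simp add: semi_riemannian_manifold_def)
qed

section \<open>The soliton equations\<close>

lemma lin_form_surj: assumes "\<alpha> \<noteq> 0" obtains x where "lin_form \<alpha> x = t"
proof -
  obtain i where "\<alpha> $ i \<noteq> 0" using assms by (auto simp: vec_eq_iff)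
  then have "lin_form \<alpha> (axis i (t / \<alpha> $ i)) = t" by simp
  then show thesis by (rule that)
qed

text \<open>The soliton equation at one point. Here \<open>s\<close> stands for \<open>S - \<rho>\<close>, \<open>p\<close> and \<open>q\<close> for the values of \<open>\<phi>\<close> and \<open>f\<close>, and
  \<open>x\<close>, \<open>y\<close>, \<open>z\<close> for the scalar coefficients of the Hessian. A base of dimension one gives a single equation for
  \<open>x\<close>, \<open>y\<close> and \<open>s\<close>, hence the bound on the dimension.\<close>

lemma hessian_equation_splits:
  fixes \<epsilon> \<alpha> :: "real^'n::finite" and \<gamma> :: "real^'d::finite^'d"
  assumes n: "2 \<le> CARD('n)" and \<epsilon>: "\<And>i. \<epsilon> $ i \<noteq> 0" and \<alpha>: "\<alpha> \<noteq> 0" and \<gamma>: "invertible \<gamma>"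
    and p: "p \<noteq> 0" and q: "q \<noteq> 0"
  shows "s *\<^sub>R block_diag (diag_matrix (\<lambda>i. \<epsilon> $ i / p\<^sup>2)) (q\<^sup>2 *\<^sub>R \<gamma>)
      = block_diag (\<chi> i j. \<alpha> $ i * \<alpha> $ j * x - \<epsilon> $ i * kronecker i j * y) (z *\<^sub>R \<gamma>)
    \<longleftrightarrow> x = 0 \<and> s = - p\<^sup>2 * y \<and> s = z / q\<^sup>2"
proof -
  have base: "(\<forall>i j. s * (if i = j then \<epsilon> $ i / p\<^sup>2 else 0) = \<alpha> $ i * \<alpha> $ j * x - \<epsilon> $ i * kronecker i j * y)
      \<longleftrightarrow> x = 0 \<and> s = - p\<^sup>2 * y" (is "?L \<longleftrightarrow> ?R")
  proof
    assume L: ?L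
    obtain i where i: "\<alpha> $ i \<noteq> 0" using \<alpha> by (auto simp: vec_eq_iff)
    obtain j where "j \<noteq> i"
    proof -
      have "UNIV \<noteq> {i}" using n by (metis card.empty card_insert_disjoint empty_iff finite.emptyI numeral_le_one_iff
            One_nat_def semiring_norm(69))
      then show thesis using that by blast
    qed
    \<comment> \<open>If \<open>\<alpha>\<^sub>j \<noteq> 0\<close> the \<open>(i,j)\<close> entry gives \<open>x = 0\<close>; otherwise the \<open>(j,j)\<close> entry determines \<open>s\<close>
      and the \<open>(i,i)\<close> entry then gives \<open>x = 0\<close>.\<close>
    have diag: "s * \<epsilon> $ k / p\<^sup>2 = \<alpha> $ k * \<alpha> $ k * x - \<epsilon> $ k * y" for k
      using L[rule_format, of k k] by simp
    have x: "x = 0"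
    proof (cases "\<alpha> $ j = 0")
      case True
      then have "\<epsilon> $ j * (s / p\<^sup>2 + y) = 0" using diag[of j] by (simp add: algebra_simps)
      then have "s / p\<^sup>2 + y = 0" using \<epsilon>[of j] by simp
      moreover have "\<epsilon> $ i * (s / p\<^sup>2 + y) = \<alpha> $ i * \<alpha> $ i * x" using diag[of i] by (simp add: algebra_simps)
      ultimately show ?thesis using i by simp
    next
      case False
      then show ?thesis using L[rule_format, of i j] i \<open>j \<noteq> i\<close> by (simp add: kronecker_def split: if_splits)
    qed
    then have "\<epsilon> $ i * (s / p\<^sup>2 + y) = 0" using diag[of i] by (simp add: algebra_simps)
    then have "s / p\<^sup>2 = - y" using \<epsilon>[of i] by simp
    then show ?R using x p by (simp add: field_simps)
  next
    assume ?R then show ?L using p by (simp add: kronecker_def)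
  qed
  have "\<gamma> \<noteq> 0"
  proof
    assume "\<gamma> = 0"
    then have "(mat 1 :: real^'d^'d) = 0"
      using invertible_matrix_inv(1)[OF \<gamma>] by (simp add: matrix_matrix_mult_def vec_eq_iff)
    then have "(mat 1 :: real^'d^'d) $ k $ k = 0" for k by simp
    then show False by (simp add: mat_def)
  qed
  then have fibre: "(s * q\<^sup>2) *\<^sub>R \<gamma> = z *\<^sub>R \<gamma> \<longleftrightarrow> s = z / q\<^sup>2"
    using q by (auto simp: field_simps)
  have "s *\<^sub>R block_diag (diag_matrix (\<lambda>i. \<epsilon> $ i / p\<^sup>2)) (q\<^sup>2 *\<^sub>R \<gamma>)
    = block_diag (s *\<^sub>R diag_matrix (\<lambda>i. \<epsilon> $ i / p\<^sup>2)) ((s * q\<^sup>2) *\<^sub>R \<gamma>)"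
    by (simp add: plus_vec_eq_iff)
  moreover have "s *\<^sub>R diag_matrix (\<lambda>i. \<epsilon> $ i / p\<^sup>2) = (\<chi> i j. \<alpha> $ i * \<alpha> $ j * x - \<epsilon> $ i * kronecker i j * y)
      \<longleftrightarrow> x = 0 \<and> s = - p\<^sup>2 * y"
    unfolding base[symmetric] vec_eq_iff by simp
  ultimately show ?thesis
    by (simp only: block_diag_eq_iff fibre conj_assoc)
qed

theorem theorem1p6:
  fixes \<epsilon> \<alpha> :: "real^'n::finite"
    and F :: "('p, 'j, 'd::finite) manifold" and gF :: "('j, 'd) tensor2"
    and a b :: ereal and \<phi> f h :: "real \<Rightarrow> real" and lamF \<rho> :: real
  assumes "3 \<le> CARD('n)"
    and "\<forall>i. \<epsilon> $ i = 1 \<or> \<epsilon> $ i = -1"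
    and "semi_riemannian_manifold F gF"
    and "topspace (Top F) \<noteq> {}"
    and "constant_scalar_curvature F gF lamF"
    and "\<alpha> \<noteq> 0"
    and "a < b"
    and "smooth_on (einterval a b) \<phi>" and "\<forall>t\<in>einterval a b. 0 < \<phi> t"
    and "smooth_on (einterval a b) f" and "\<forall>t\<in>einterval a b. 0 < f t"
    and "smooth_on (einterval a b) h" and "\<forall>t\<in>einterval a b. 0 < h t"
  shows
    "(pseudo_norm_sq \<epsilon> \<alpha> \<noteq> 0 \<longrightarrow>
       (gradient_yamabe_soliton (prod_manifold (strip \<alpha> a b) F) (soliton_metric \<epsilon> \<alpha> a b \<phi> f gF)
          (\<lambda>(x, p). h (lin_form \<alpha> x)) \<rho>
        \<longleftrightarrow>
        (\<forall>t\<in>einterval a b.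
           deriv (deriv h) t + 2 * (deriv \<phi> t * deriv h t / \<phi> t) = 0 \<and>
           pseudo_norm_sq \<epsilon> \<alpha> *
             ((real CARD('n) - 1) * (2 * \<phi> t * deriv (deriv \<phi>) t - real CARD('n) * (deriv \<phi> t)\<^sup>2)
              - 2 * real CARD('d) / f t
                  * ((\<phi> t)\<^sup>2 * deriv (deriv f) t - (real CARD('n) - 2) * \<phi> t * deriv \<phi> t * deriv f t)
              - real CARD('d) * (real CARD('d) - 1) / (f t)\<^sup>2 * (\<phi> t)\<^sup>2 * (deriv f t)\<^sup>2
              + \<phi> t * deriv \<phi> t * deriv h t)
             = \<rho> - lamF / (f t)\<^sup>2 \<and>
           pseudo_norm_sq \<epsilon> \<alpha> *
             ((real CARD('n) - 1) * (2 * \<phi> t * deriv (deriv \<phi>) t - real CARD('n) * (deriv \<phi> t)\<^sup>2)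
              - 2 * real CARD('d) / f t
                  * ((\<phi> t)\<^sup>2 * deriv (deriv f) t - (real CARD('n) - 2) * \<phi> t * deriv \<phi> t * deriv f t)
              - real CARD('d) * (real CARD('d) - 1) / (f t)\<^sup>2 * (\<phi> t)\<^sup>2 * (deriv f t)\<^sup>2
              - (\<phi> t)\<^sup>2 / f t * deriv f t * deriv h t)
             = \<rho> - lamF / (f t)\<^sup>2))) \<and>
     (pseudo_norm_sq \<epsilon> \<alpha> = 0 \<longrightarrow>
       (gradient_yamabe_soliton (prod_manifold (strip \<alpha> a b) F) (soliton_metric \<epsilon> \<alpha> a b \<phi> f gF)
          (\<lambda>(x, p). h (lin_form \<alpha> x)) \<rho>
        \<longleftrightarrow>
        (\<forall>t\<in>einterval a b.
           deriv (deriv h) t + 2 * (deriv \<phi> t * deriv h t / \<phi> t) = 0 \<and>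
           \<rho> - lamF / (f t)\<^sup>2 = 0)))"
proof -
  let ?I = "einterval a b" and ?N = "pseudo_norm_sq \<epsilon> \<alpha>" and ?n = "real CARD('n)" and ?d = "real CARD('d)"
  let ?U = "lin_form \<alpha> -` ?I" and ?w = "\<lambda>x. f (lin_form \<alpha> x)"
  let ?M = "prod_manifold (strip \<alpha> a b) F" and ?g = "soliton_metric \<epsilon> \<alpha> a b \<phi> f gF"
  let ?u = "\<lambda>(x, p). h (lin_form \<alpha> x)"
  note \<epsilon> = assms(2) and F = assms(3) and \<alpha> = assms(6)
  note pos = assms(9)[rule_format] assms(11)[rule_format]
  have I: "open ?I" by (rule open_einterval)
  have U: "open ?U"
    using open_vimage[OF I] linear_continuous_on[OF bounded_linear_lin_form] by blast
  have sub: "smooth_on ?U (\<lambda>x. u (lin_form \<alpha> x))" if "smooth_on ?I u" for u :: "real \<Rightarrow> real"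
    by (rule smooth_on_linear_substitution[OF bounded_linear_lin_form I that])
  have B: "semi_riemannian_manifold (strip \<alpha> a b) (conformal_flat_metric \<epsilon> (\<lambda>x. \<phi> (lin_form \<alpha> x)))"
    unfolding strip_def by (rule semi_riemannian_conformal_flat[OF U sub[OF assms(8)] _ \<epsilon>]) (use pos in fastforce)
  have smB: "smooth_manifold (strip \<alpha> a b)" and smF: "smooth_manifold F"
    and gF: "semi_riemannian_metric F gF"
    using B F by (auto simp: semi_riemannian_manifold_def)
  have M: "semi_riemannian_manifold ?M ?g"
    unfolding soliton_metric_def
  proof (rule semi_riemannian_warped_metric[OF B F])
    show "smooth_function (strip \<alpha> a b) ?w"
      unfolding strip_def by (rule smooth_function_open_submanifold[OF U sub[OF assms(10)]])
    show "?w p \<noteq> 0" if "p \<in> topspace (Top (strip \<alpha> a b))" for p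
      using that pos(2)[of "lin_form \<alpha> p"] by (auto simp: strip_def)
  qed
  have u: "smooth_function ?M ?u"
    by (rule smooth_function_prod_fst[OF smB smF])
       (unfold strip_def, rule smooth_function_open_submanifold[OF U sub[OF assms(12)]])
  let ?S = "\<lambda>t. ?N * ((?n - 1) * (2 * \<phi> t * deriv (deriv \<phi>) t - ?n * (deriv \<phi> t)\<^sup>2)
      - 2 * ?d / f t * ((\<phi> t)\<^sup>2 * deriv (deriv f) t - (?n - 2) * \<phi> t * deriv \<phi> t * deriv f t)
      - ?d * (?d - 1) / (f t)\<^sup>2 * (\<phi> t)\<^sup>2 * (deriv f t)\<^sup>2) + lamF / (f t)\<^sup>2"
  let ?x = "\<lambda>t. deriv (deriv h) t + 2 * (deriv \<phi> t * deriv h t / \<phi> t)"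
  let ?E = "\<lambda>t. ?x t = 0 \<and> ?S t - \<rho> = - ?N * \<phi> t * deriv \<phi> t * deriv h t
      \<and> ?S t - \<rho> = ?N * (\<phi> t)\<^sup>2 / f t * deriv f t * deriv h t"
  have Img: "Img ?M (i, j) = {z. lin_form \<alpha> (left z) \<in> ?I \<and> right z \<in> Img F j}" for i j
    by (auto simp: Img_prod strip_def)
  \<comment> \<open>The soliton equation at a point of a chart depends on the value of \<open>\<xi>\<close> there only.\<close>
  have pointwise: "(scalar_curvature (?g (i, j)) z - \<rho>) *\<^sub>R ?g (i, j) z = hessian (?g (i, j)) (in_chart ?M (i, j) ?u) z
      \<longleftrightarrow> ?E (lin_form \<alpha> (left z))"
    if j: "j \<in> Idx F" and z: "z \<in> Img ?M (i, j)" for i j z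
  proof -
    interpret local_soliton_metric \<epsilon> \<alpha> ?I \<phi> "deriv \<phi>" "deriv (deriv \<phi>)" f "deriv f" "deriv (deriv f)"
      "Img F j" "gF j" "?g (i, j)"
    proof
      show "open ?I" by (rule I)
      show "open (Img F j)" by (rule open_Img[OF smF j])
      show "\<epsilon> $ i * \<epsilon> $ i = 1" for i using \<epsilon> by (metis mult_minus1 mult_1 minus_minus)
      have sm: "smooth_on (Img F j) (\<lambda>y. gF j y $ p $ q)" for p q
        using gF j unfolding semi_riemannian_metric_def by blast
      fix y assume y: "y \<in> Img F j"
      show "transpose (gF j y) = gF j y" "invertible (gF j y)"
        using gF j y unfolding semi_riemannian_metric_def by blast+
      show "(\<lambda>w. gF j w $ p $ q) differentiable at y" for p q
        by (rule smooth_on_differentiable[OF open_Img[OF smF j] sm y])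
      show "partial r (\<lambda>w. gF j w $ p $ q) differentiable at y" for p q r
        by (rule smooth_on_differentiable[OF open_Img[OF smF j] smooth_on_partial[OF sm] y])
    next
      fix t assume t: "t \<in> ?I"
      show "0 < \<phi> t" "0 < f t" using pos t by auto
      show "(\<phi> has_real_derivative deriv \<phi> t) (at t)" "(f has_real_derivative deriv f t) (at t)"
        "(deriv \<phi> has_real_derivative deriv (deriv \<phi>) t) (at t)"
        "(deriv f has_real_derivative deriv (deriv f) t) (at t)"
        by (rule smooth_on_has_real_derivative[OF I _ t], (rule smooth_on_deriv[OF I])?, rule assms)+
    next
      fix z :: "real^('n + 'd)" assume "lin_form \<alpha> (left z) \<in> ?I" "right z \<in> Img F j"
      then show "?g (i, j) z = block_diag (diag_matrix (\<lambda>i. \<epsilon> $ i / (\<phi> (lin_form \<alpha> (left z)))\<^sup>2))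
                       ((f (lin_form \<alpha> (left z)))\<^sup>2 *\<^sub>R gF j (right z))"
        by (simp add: soliton_metric_def warped_metric_eq_block_diag conformal_flat_metric_def strip_def diag_matrix_def)
    qed
    have W_eq: "W = Img ?M (i, j)" unfolding W_def Img ..
    have z: "z \<in> W" using z by (simp add: W_eq)
    let ?t = "lin_form \<alpha> (left z)"
    note W = W_D[OF z]
    have "scalar_curvature (gF j) (right z) = lamF"
      using assms(5) j W(2) unfolding constant_scalar_curvature_def by blast
    then have S: "scalar_curvature (?g (i, j)) z = ?S ?t"
      by (simp only: scalar_curvature_G[OF z])
    have H: "hessian (?g (i, j)) (in_chart ?M (i, j) ?u) z = block_diag
      (\<chi> k l. \<alpha> $ k * \<alpha> $ l * ?x ?t - \<epsilon> $ k * kronecker k l * (deriv \<phi> ?t * deriv h ?t / \<phi> ?t * ?N))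
      ((?N * (\<phi> ?t)\<^sup>2 * f ?t * deriv f ?t * deriv h ?t) *\<^sub>R gF j (right z))"
    proof (rule hessian_of_profile[OF z])
      fix y assume y: "y \<in> W"
      have "i \<in> Idx (strip \<alpha> a b)" by (simp add: strip_def)
      from in_chart_prod_fst[OF smB smF this j y[unfolded W_eq]]
      show "in_chart ?M (i, j) ?u y = h (lin_form \<alpha> (left y))"
        using W_D(1)[OF y] by (simp add: strip_def)
    next
      fix t assume t: "t \<in> ?I"
      show "(h has_real_derivative deriv h t) (at t)" "(deriv h has_real_derivative deriv (deriv h) t) (at t)"
        by (rule smooth_on_has_real_derivative[OF I _ t], (rule smooth_on_deriv[OF I])?, rule assms)+
    qed
    have "(scalar_curvature (?g (i, j)) z - \<rho>) *\<^sub>R ?g (i, j) z = hessian (?g (i, j)) (in_chart ?M (i, j) ?u) z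
      \<longleftrightarrow> ?x ?t = 0 \<and> ?S ?t - \<rho> = - (\<phi> ?t)\<^sup>2 * (deriv \<phi> ?t * deriv h ?t / \<phi> ?t * ?N)
        \<and> ?S ?t - \<rho> = ?N * (\<phi> ?t)\<^sup>2 * f ?t * deriv f ?t * deriv h ?t / (f ?t)\<^sup>2"
      unfolding H S G[OF W(1,2)]
      by (rule hessian_equation_splits) (use assms(1) \<epsilon>_nz \<alpha> \<gamma>_inv W in auto)
    moreover have "- (\<phi> ?t)\<^sup>2 * (deriv \<phi> ?t * deriv h ?t / \<phi> ?t * ?N) = - ?N * \<phi> ?t * deriv \<phi> ?t * deriv h ?t"
      "?N * (\<phi> ?t)\<^sup>2 * f ?t * deriv f ?t * deriv h ?t / (f ?t)\<^sup>2 = ?N * (\<phi> ?t)\<^sup>2 / f ?t * deriv f ?t * deriv h ?t"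
      using W(3,4) by (simp_all add: field_simps power2_eq_square)
    ultimately show ?thesis by (simp only:)
  qed
  have "gradient_yamabe_soliton ?M ?g ?u \<rho> \<longleftrightarrow> (\<forall>t\<in>?I. ?E t)"
  proof
    assume L: "gradient_yamabe_soliton ?M ?g ?u \<rho>"
    show "\<forall>t\<in>?I. ?E t"
    proof
      fix t assume t: "t \<in> ?I"
      obtain x where x: "lin_form \<alpha> x = t" using lin_form_surj[OF \<alpha>] .
      have "topspace (Top F) = (\<Union>i\<in>Idx F. Dom F i)" using smF by (simp add: smooth_manifold_def)
      then obtain j p where j: "j \<in> Idx F" "p \<in> Dom F j" using assms(4) by auto
      let ?z = "join x (Coord F j p)"
      have z: "?z \<in> Img ?M ((), j)" using x t j by (auto simp: Img) (auto simp: Img_def)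
      have "((), j) \<in> Idx ?M" using j by (simp add: strip_def)
      then have "(scalar_curvature (?g ((), j)) ?z - \<rho>) *\<^sub>R ?g ((), j) ?z = hessian (?g ((), j)) (in_chart ?M ((), j) ?u) ?z"
        using L z unfolding gradient_yamabe_soliton_def by blast
      then have "?E (lin_form \<alpha> (left ?z))" using pointwise[OF j(1) z] by blast
      then show "?E t" unfolding left_join x .
    qed
  next
    assume R: "\<forall>t\<in>?I. ?E t"
    have "(scalar_curvature (?g k) z - \<rho>) *\<^sub>R ?g k z = hessian (?g k) (in_chart ?M k ?u) z"
      if k: "k \<in> Idx ?M" and z: "z \<in> Img ?M k" for k z
    proof -
      obtain i j where ij: "k = (i, j)" "j \<in> Idx F" using k by auto
      have "lin_form \<alpha> (left z) \<in> ?I" using z unfolding ij Img by simp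
      then show ?thesis
        unfolding ij(1) pointwise[OF ij(2) z[unfolded ij(1)]] using R by blast
    qed
    then show "gradient_yamabe_soliton ?M ?g ?u \<rho>"
      unfolding gradient_yamabe_soliton_def using M u by blast
  qed
  note main = this
  show ?thesis
    unfolding main
  proof (intro conjI impI)
    show "(\<forall>t\<in>?I. ?E t) \<longleftrightarrow> (\<forall>t\<in>?I. ?x t = 0 \<and>
      ?N * ((?n - 1) * (2 * \<phi> t * deriv (deriv \<phi>) t - ?n * (deriv \<phi> t)\<^sup>2)
        - 2 * ?d / f t * ((\<phi> t)\<^sup>2 * deriv (deriv f) t - (?n - 2) * \<phi> t * deriv \<phi> t * deriv f t)
        - ?d * (?d - 1) / (f t)\<^sup>2 * (\<phi> t)\<^sup>2 * (deriv f t)\<^sup>2 + \<phi> t * deriv \<phi> t * deriv h t) = \<rho> - lamF / (f t)\<^sup>2 \<and>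
      ?N * ((?n - 1) * (2 * \<phi> t * deriv (deriv \<phi>) t - ?n * (deriv \<phi> t)\<^sup>2)
        - 2 * ?d / f t * ((\<phi> t)\<^sup>2 * deriv (deriv f) t - (?n - 2) * \<phi> t * deriv \<phi> t * deriv f t)
        - ?d * (?d - 1) / (f t)\<^sup>2 * (\<phi> t)\<^sup>2 * (deriv f t)\<^sup>2 - (\<phi> t)\<^sup>2 / f t * deriv f t * deriv h t) = \<rho> - lamF / (f t)\<^sup>2)"
    proof (rule ball_cong[OF refl], intro conj_cong refl)
      fix t
      have rearrange: "N * X + l - r = - N * p * q * s \<longleftrightarrow> N * (X + p * q * s) = r - l"
        "N * X + l - r = N * e * p * q \<longleftrightarrow> N * (X - e * p * q) = r - l" for N X l r p q s e :: real
        by (auto simp: algebra_simps)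
      show "?S t - \<rho> = - ?N * \<phi> t * deriv \<phi> t * deriv h t \<longleftrightarrow>
        ?N * ((?n - 1) * (2 * \<phi> t * deriv (deriv \<phi>) t - ?n * (deriv \<phi> t)\<^sup>2)
        - 2 * ?d / f t * ((\<phi> t)\<^sup>2 * deriv (deriv f) t - (?n - 2) * \<phi> t * deriv \<phi> t * deriv f t)
        - ?d * (?d - 1) / (f t)\<^sup>2 * (\<phi> t)\<^sup>2 * (deriv f t)\<^sup>2 + \<phi> t * deriv \<phi> t * deriv h t) = \<rho> - lamF / (f t)\<^sup>2"
        by (rule rearrange(1))
      have "?N * (\<phi> t)\<^sup>2 / f t * deriv f t * deriv h t = ?N * ((\<phi> t)\<^sup>2 / f t) * deriv f t * deriv h t" by simp
      then show "?S t - \<rho> = ?N * (\<phi> t)\<^sup>2 / f t * deriv f t * deriv h t \<longleftrightarrow>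
        ?N * ((?n - 1) * (2 * \<phi> t * deriv (deriv \<phi>) t - ?n * (deriv \<phi> t)\<^sup>2)
        - 2 * ?d / f t * ((\<phi> t)\<^sup>2 * deriv (deriv f) t - (?n - 2) * \<phi> t * deriv \<phi> t * deriv f t)
        - ?d * (?d - 1) / (f t)\<^sup>2 * (\<phi> t)\<^sup>2 * (deriv f t)\<^sup>2 - (\<phi> t)\<^sup>2 / f t * deriv f t * deriv h t) = \<rho> - lamF / (f t)\<^sup>2"
        using rearrange(2) by (simp only:)
    qed
  next
    assume N0: "?N = 0"
    show "(\<forall>t\<in>?I. ?E t) \<longleftrightarrow> (\<forall>t\<in>?I. ?x t = 0 \<and> \<rho> - lamF / (f t)\<^sup>2 = 0)"
      unfolding N0 by (intro ball_cong refl conj_cong) auto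
  qed
qed

end
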